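(* Let $\delta\in(0,\alpha)$. There are positive constants $C_1,C_2$ depending only on $\delta$ and $\alpha$ such that, for all sufficiently large $t$ and all $r>0$, $$P\left(|l_t-\mathbb{E}l_t|\ge r\sqrt{\log t}\right)\le C_1\exp\left\{-C_2r^2\right\}.$$
   Context: Fix $\alpha\in(0,1)$, $\sigma=\sqrt{\alpha(1-\alpha)}$ and $\sigma_t=\sigma/\sqrt t$. Let $W$ be a standard two-dimensional Brownian motion on $[0,1]$. The scaled two-dimensional Conga line at time $t$ is the random curve $$u_t(x)=\int_0^1W(1-z)\frac{1}{\sqrt{2\pi}}\,\frac{x+\alpha z}{2\sigma_t z^{3/2}}\exp\left(-\frac{(x-\alpha z)^2}{2\sigma_t^2z}\right)dz,\qquad 0<x\le 1 .$$ $l_t=\int_\delta^\alpha|u_t'(x)|\,dx$ is its length on $[\delta,\alpha]$, where $|\cdot|$ is the Euclidean norm and $u_t'$ the derivative in $x$. *)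

theory Defs
  imports "HOL-Probability.Probability"
begin

text \<open>
  Standard Brownian motion on the time interval \<open>[0,1]\<close>.  Every path is required to be continuous
  (rather than almost every path), so that functionals of the path are random variables without
  completing the underlying probability space.  The density of an increment is that of a centred
  Gaussian vector with covariance matrix \<open>(t - s)\<close> times the identity.  Values of \<open>W\<close> at times
  outside \<open>[0,1]\<close> are unconstrained.
\<close>

locale standard_brownian_motion = prob_space M
  for M :: "'a measure" +
  fixes W :: "real \<Rightarrow> 'a \<Rightarrow> 'b :: euclidean_space"
  assumes measurable_W: "s \<in> {0..1} \<Longrightarrow> W s \<in> borel_measurable M"
    and start: "AE \<omega> in M. W 0 \<omega> = 0"
    and indep_increments:
      "0 \<le> \<tau> 0 \<Longrightarrow> (\<And>i. i < n \<Longrightarrow> \<tau> i < \<tau> (Suc i)) \<Longrightarrow> \<tau> n \<le> 1 \<Longrightarrow>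
        indep_vars (\<lambda>_. borel) (\<lambda>i \<omega>. W (\<tau> (Suc i)) \<omega> - W (\<tau> i) \<omega>) {..<n :: nat}"
    and normal_increments:
      "0 \<le> s \<Longrightarrow> s < t \<Longrightarrow> t \<le> 1 \<Longrightarrow>
        distributed M lborel (\<lambda>\<omega>. W t \<omega> - W s \<omega>)
          (\<lambda>y. ennreal (\<Prod>b\<in>Basis. normal_density 0 (sqrt (t - s)) (y \<bullet> b)))"
    and continuous_paths: "\<omega> \<in> space M \<Longrightarrow> continuous_on {0..1} (\<lambda>s. W s \<omega>)"

definition sigma_t :: "real \<Rightarrow> real \<Rightarrow> real" where
  "sigma_t \<alpha> t = sqrt (\<alpha> * (1 - \<alpha>)) / sqrt t"

text \<open>
  The curve and its length as functionals of a path \<open>w\<close>.  At the endpoint \<open>z = 0\<close> the integrand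
  is \<open>0\<close> by the convention for division by zero.
\<close>

definition conga_line :: "real \<Rightarrow> real \<Rightarrow> (real \<Rightarrow> real^2) \<Rightarrow> real \<Rightarrow> real^2" where
  "conga_line \<alpha> t w x =
    (LINT z:{0..1}|lborel.
      (1 / sqrt (2 * pi) * ((x + \<alpha> * z) / (2 * sigma_t \<alpha> t * z powr (3/2)))
        * exp (- ((x - \<alpha> * z)\<^sup>2 / (2 * (sigma_t \<alpha> t)\<^sup>2 * z)))) *\<^sub>R w (1 - z))"

definition conga_length :: "real \<Rightarrow> real \<Rightarrow> real \<Rightarrow> (real \<Rightarrow> real^2) \<Rightarrow> real" where
  "conga_length \<alpha> \<delta> t w =
    (LINT x:{\<delta>..\<alpha>}|lborel. norm (vector_derivative (conga_line \<alpha> t w) (at x)))"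

end

theory Submission
  imports Defs
begin

text \<open>
  The length is a Lipschitz function of the increments of the Brownian path, with a constant that
  depends on none of \<open>t\<close>, \<open>\<alpha>\<close>, \<open>\<delta>\<close>, and therefore has Gaussian tails on the scale \<open>1\<close>, which is
  finer than the scale \<open>sqrt (ln t)\<close> of the theorem as soon as \<open>t \<ge> exp 1\<close>.

  Write \<open>K(x, z)\<close> for the kernel of the Conga line, \<open>s\<close> for \<open>sigma_t \<alpha> t\<close>, and let \<open>N(x, z)\<close> be the
  density at \<open>x\<close> of the normal distribution with mean \<open>\<alpha> z\<close> and variance \<open>s\<^sup>2 z\<close>.  Then
  \<open>K(x, z) = (x + \<alpha> z) / (2 z) * N(x, z)\<close>, and a computation shows that the derivative of \<open>K\<close> in \<open>x\<close>
  is minus the derivative of \<open>N\<close> in \<open>z\<close> (\<open>has_real_derivative_conga_kernel\<close>, \<open>has_real_derivative_drift_density\<close>).  Hence a path that jumps by a vector \<open>y\<close> at time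
  \<open>1 - z\<close> contributes \<open>- N(x, z) y\<close> to the velocity at \<open>x\<close>, and as \<open>N(_, z)\<close> is a probability
  density it contributes at most \<open>norm y\<close> to the length.  Replacing a continuous path by its values
  at the times \<open>i / n\<close> therefore presents the length as the limit of functions of the \<open>n\<close> increments
  that change by at most the sum of the norms of the changes of the increments
  (\<open>conga_length_eq_lim\<close>, \<open>set_integral_norm_sum_lipschitz\<close>).

  Each increment has standard deviation \<open>1 / sqrt n\<close> in every direction and they are independent, so
  \<open>n\<close> coordinates contribute \<open>n * (1 / n)\<close> to the variance proxy, uniformly in \<open>n\<close>.  This is proved for
  the product \<open>E(exp (\<kappa> l)) E(exp (- \<kappa> l))\<close>, which is blind to the value of the mean of \<open>l\<close>:  it tensorises
  over independent coordinates (\<open>product_nn_integral_times_reciprocal_le\<close>), passes to the limit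
  \<open>n \<rightarrow> \<infinity>\<close> by Fatou's lemma without any integrability assumption
  (\<open>nn_integral_exp_times_exp_minus_limit\<close>), and still yields both tails of \<open>l - E l\<close>, since by
  Jensen's inequality each of the two factors is at least \<open>1\<close> after centring (\<open>subgaussian_tail\<close>).
\<close>

section \<open>Exponential moments of Lipschitz functions of independent Gaussian vectors\<close>

lemma cosh_real_le_exp_half_square:
  fixes x :: real
  shows "cosh x \<le> exp (x\<^sup>2 / 2)"
proof -
  have pos: "cosh x \<le> exp (x\<^sup>2 / 2)" if "0 \<le> x" for x :: real
  proof -
    have sinh_le: "sinh y \<le> y * cosh y" if "0 \<le> y" for y :: real
    proof -
      have "(\<lambda>u::real. u * cosh u - sinh u) 0 \<le> (\<lambda>u::real. u * cosh u - sinh u) y"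
      proof (rule DERIV_nonneg_imp_nondecreasing[OF that])
        fix u :: real assume "0 \<le> u" "u \<le> y"
        have "((\<lambda>u. u * cosh u - sinh u) has_real_derivative u * sinh u) (at u)"
          by (auto intro!: derivative_eq_intros)
        moreover have "0 \<le> u * sinh u" using \<open>0 \<le> u\<close> by simp
        ultimately show "\<exists>d. ((\<lambda>u. u * cosh u - sinh u) has_real_derivative d) (at u) \<and> 0 \<le> d"
          by blast
      qed
      then show ?thesis by simp
    qed
    have "(\<lambda>u::real. cosh u * exp (- (u\<^sup>2 / 2))) x \<le> (\<lambda>u::real. cosh u * exp (- (u\<^sup>2 / 2))) 0"
    proof (rule DERIV_nonpos_imp_nonincreasing[OF that])
      fix u :: real assume "0 \<le> u" "u \<le> x"
      have "((\<lambda>u. cosh u * exp (- (u\<^sup>2 / 2))) has_real_derivative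
          (sinh u - u * cosh u) * exp (- (u\<^sup>2 / 2))) (at u)"
        by (auto intro!: derivative_eq_intros simp: algebra_simps)
      moreover have "(sinh u - u * cosh u) * exp (- (u\<^sup>2 / 2)) \<le> 0"
        using sinh_le[OF \<open>0 \<le> u\<close>] by (simp add: mult_nonpos_nonneg)
      ultimately show "\<exists>d. ((\<lambda>u. cosh u * exp (- (u\<^sup>2 / 2))) has_real_derivative d) (at u) \<and> d \<le> 0"
        by blast
    qed
    then show ?thesis by (simp add: exp_minus field_simps)
  qed
  show ?thesis using pos[of x] pos[of "-x"] by (cases "0 \<le> x") auto
qed

text \<open>The ratio \<open>p / q\<close> lies between \<open>exp (- a)\<close> and \<open>exp a\<close>, and \<open>r + 1 / r\<close> is largest at the endpoints.\<close>

lemma ratio_add_inverse_le_cosh: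
  fixes p q a :: real
  assumes "0 < p" "0 < q" and pq: "p \<le> exp a * q" and qp: "q \<le> exp a * p"
  shows "p / q + q / p \<le> 2 * cosh a"
proof -
  define r where "r = p / q"
  have r: "0 < r" "r \<le> exp a" "exp (- a) \<le> r"
    using assms by (auto simp: r_def field_simps exp_minus)
  have "0 \<le> (exp a - r) * (r - exp (- a))" using r by simp
  also have "\<dots> = r * (exp a + exp (- a)) - r\<^sup>2 - 1"
    by (simp add: algebra_simps power2_eq_square exp_minus)
  finally have "r + 1 / r \<le> exp a + exp (- a)"
    using r(1) by (simp add: field_simps power2_eq_square)
  moreover have "1 / r = q / p" by (simp add: r_def)
  moreover have "2 * cosh a = exp a + exp (- a)" by (simp add: cosh_def)
  ultimately show ?thesis by (simp only: r_def)
qed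

text \<open>
  The one-coordinate case of tensorisation.  The product of the two integrals is a double integral of
  \<open>f y / f y'\<close>, where \<open>y\<close> and \<open>y'\<close> may be exchanged; averaging the two forms replaces the bound
  \<open>exp (\<kappa> |y - y'|)\<close> by \<open>cosh (\<kappa> |y - y'|)\<close>, whose deviation from \<open>1\<close> is of second order.
\<close>

lemma nn_integral_times_reciprocal_le:
  fixes \<mu> :: "'b::{real_normed_vector, second_countable_topology} measure" and f :: "'b \<Rightarrow> ennreal"
  assumes "prob_space \<mu>" and sets[measurable_cong]: "sets \<mu> = sets borel"
    and f[measurable]: "f \<in> borel_measurable \<mu>" and f_fin: "\<And>y. f y \<noteq> 0" "\<And>y. f y \<noteq> \<infinity>"
    and lip: "\<And>y y'. f y \<le> ennreal (exp (\<kappa> * norm (y - y'))) * f y'"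
  shows "(\<integral>\<^sup>+y. f y \<partial>\<mu>) * (\<integral>\<^sup>+y. inverse (f y) \<partial>\<mu>)
    \<le> (\<integral>\<^sup>+y. \<integral>\<^sup>+y'. ennreal (cosh (\<kappa> * norm (y - y'))) \<partial>\<mu> \<partial>\<mu>)" (is "?A \<le> ?C")
proof -
  interpret prob_space \<mu> by fact
  have A1: "?A = (\<integral>\<^sup>+y. \<integral>\<^sup>+y'. f y * inverse (f y') \<partial>\<mu> \<partial>\<mu>)"
    by (simp add: nn_integral_cmult nn_integral_multc)
  have A2: "?A = (\<integral>\<^sup>+y. \<integral>\<^sup>+y'. f y' * inverse (f y) \<partial>\<mu> \<partial>\<mu>)"
    by (simp add: nn_integral_cmult nn_integral_multc)
  have pt: "f y * inverse (f y') + f y' * inverse (f y) \<le> 2 * ennreal (cosh (\<kappa> * norm (y - y')))" for y y'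
  proof -
    obtain p where p: "f y = ennreal p" "0 < p"
      using f_fin[of y] by (cases "f y") (auto simp: less_le)
    obtain q where q: "f y' = ennreal q" "0 < q"
      using f_fin[of y'] by (cases "f y'") (auto simp: less_le)
    have "p \<le> exp (\<kappa> * norm (y - y')) * q" "q \<le> exp (\<kappa> * norm (y - y')) * p"
      using lip[of y y'] lip[of y' y] p q
      by (auto simp: ennreal_mult'[symmetric] norm_minus_commute)
    from ratio_add_inverse_le_cosh[OF p(2) q(2) this] show ?thesis
      using p q by (simp add: inverse_ennreal ennreal_mult[symmetric] ennreal_plus[symmetric]
          divide_inverse ennreal_le_iff flip: ennreal_numeral del: ennreal_plus)
  qed
  have "2 * ?A = ?A + ?A" by (simp add: mult_2)
  also have "\<dots> = (\<integral>\<^sup>+y. \<integral>\<^sup>+y'. f y * inverse (f y') \<partial>\<mu> \<partial>\<mu>) + (\<integral>\<^sup>+y. \<integral>\<^sup>+y'. f y' * inverse (f y) \<partial>\<mu> \<partial>\<mu>)"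
    using A1 A2 by simp
  also have "\<dots> = (\<integral>\<^sup>+y. \<integral>\<^sup>+y'. f y * inverse (f y') + f y' * inverse (f y) \<partial>\<mu> \<partial>\<mu>)"
    by (simp add: nn_integral_add)
  also have "\<dots> \<le> (\<integral>\<^sup>+y. \<integral>\<^sup>+y'. 2 * ennreal (cosh (\<kappa> * norm (y - y'))) \<partial>\<mu> \<partial>\<mu>)"
    by (intro nn_integral_mono pt)
  also have "\<dots> = 2 * ?C"
  proof -
    have m1: "(\<lambda>y'. ennreal (cosh (\<kappa> * norm (y - y')))) \<in> borel_measurable \<mu>" for y
      unfolding cosh_field_def by measurable
    have m2: "(\<lambda>y. \<integral>\<^sup>+y'. ennreal (cosh (\<kappa> * norm (y - y'))) \<partial>\<mu>) \<in> borel_measurable \<mu>"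
      unfolding cosh_field_def by measurable
    show ?thesis by (simp add: nn_integral_cmult m1 m2)
  qed
  finally show ?thesis
    by (simp add: ennreal_mult_le_mult_iff)
qed

text \<open>
  Induction on the coordinates.  Integrating out coordinate \<open>i\<close> turns \<open>F\<close> into a function \<open>G\<close> of the
  remaining ones with the same Lipschitz property, and turns \<open>1 / F\<close> into a function \<open>H\<close> with
  \<open>H \<le> b / G\<close>, by the one-coordinate case.  So each coordinate costs a factor \<open>b\<close>.
\<close>

lemma product_nn_integral_times_reciprocal_le:
  fixes \<mu> :: "'b::{real_normed_vector, second_countable_topology} measure"
    and F :: "('i \<Rightarrow> 'b) \<Rightarrow> ennreal"
  assumes "prob_space \<mu>" and sets[measurable_cong]: "sets \<mu> = sets borel"
    and b: "(\<integral>\<^sup>+y. \<integral>\<^sup>+y'. ennreal (cosh (\<kappa> * norm (y - y'))) \<partial>\<mu> \<partial>\<mu>) \<le> ennreal b"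
    and "finite I" and "F \<in> borel_measurable (Pi\<^sub>M I (\<lambda>_. \<mu>))"
    and "\<And>x. x \<in> space (Pi\<^sub>M I (\<lambda>_. \<mu>)) \<Longrightarrow> F x \<noteq> 0"
    and "\<And>x. x \<in> space (Pi\<^sub>M I (\<lambda>_. \<mu>)) \<Longrightarrow> F x \<noteq> \<infinity>"
    and "\<And>x x'. x \<in> space (Pi\<^sub>M I (\<lambda>_. \<mu>)) \<Longrightarrow> x' \<in> space (Pi\<^sub>M I (\<lambda>_. \<mu>)) \<Longrightarrow>
      F x \<le> ennreal (exp (\<kappa> * (\<Sum>i\<in>I. norm (x i - x' i)))) * F x'"
  shows "(\<integral>\<^sup>+x. F x \<partial>Pi\<^sub>M I (\<lambda>_. \<mu>)) * (\<integral>\<^sup>+x. inverse (F x) \<partial>Pi\<^sub>M I (\<lambda>_. \<mu>)) \<le> ennreal b ^ card I"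
  using assms(4-)
proof (induction I arbitrary: F rule: finite_induct)
  case empty
  have "F (\<lambda>k. undefined) \<noteq> 0" "F (\<lambda>k. undefined) \<noteq> \<infinity>"
    using empty(2,3)[of "\<lambda>k. undefined"] by (auto simp: space_PiM)
  then have "F (\<lambda>k. undefined) * inverse (F (\<lambda>k. undefined)) = 1"
    by (metis divide_ennreal_def ennreal_divide_self infinity_ennreal_def top.not_eq_extremum)
  then show ?case
    by (simp add: PiM_empty nn_integral_count_space_finite)
next
  case (insert i I)
  note F[measurable] = insert.prems(1)
  interpret mu: prob_space \<mu> by fact
  interpret P: product_prob_space "\<lambda>_::'i. \<mu>" by unfold_locales
  have sp_mu: "space \<mu> = UNIV" using sets_eq_imp_space_eq[OF sets] by simp
  let ?S = "space (Pi\<^sub>M I (\<lambda>_. \<mu>))"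
  have upd: "x(i := y) \<in> space (Pi\<^sub>M (insert i I) (\<lambda>_. \<mu>))" if "x \<in> ?S" for x y
    using that insert.hyps(2) by (auto simp: space_PiM sp_mu PiE_def extensional_def)
  define G where "G x = (\<integral>\<^sup>+y. F (x(i := y)) \<partial>\<mu>)" for x
  define H where "H x = (\<integral>\<^sup>+y. inverse (F (x(i := y))) \<partial>\<mu>)" for x
  have Fm: "(\<lambda>y. F (x(i := y))) \<in> borel_measurable \<mu>" if "x \<in> ?S" for x
    by (rule measurable_compose[OF _ F], rule measurable_fun_upd[where J = I]) (use that in auto)
  have Gm[measurable]: "G \<in> borel_measurable (Pi\<^sub>M I (\<lambda>_. \<mu>))"
    unfolding G_def by measurable
  have Hm[measurable]: "H \<in> borel_measurable (Pi\<^sub>M I (\<lambda>_. \<mu>))"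
    unfolding H_def by measurable
  have GH: "G x * H x \<le> ennreal b" if x: "x \<in> ?S" for x
    unfolding G_def H_def
  proof (rule order_trans[OF nn_integral_times_reciprocal_le[OF \<open>prob_space \<mu>\<close> sets Fm[OF x]] b])
    fix y y'
    show "F (x(i := y)) \<noteq> 0" "F (x(i := y)) \<noteq> \<infinity>" using insert.prems(2,3) upd[OF x] by auto
    have eq: "(\<Sum>j\<in>insert i I. norm ((x(i := y)) j - (x(i := y')) j)) = norm (y - y')"
      using insert.hyps by (simp add: sum.neutral)
    then show "F (x(i := y)) \<le> ennreal (exp (\<kappa> * norm (y - y'))) * F (x(i := y'))"
      using insert.prems(4)[OF upd[OF x, of y] upd[OF x, of y']] by (simp only: eq)
  qed
  have pos: "(\<integral>\<^sup>+y. f y \<partial>\<mu>) \<noteq> 0"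
    if "f \<in> borel_measurable \<mu>" "\<And>y. f y \<noteq> 0" for f :: "'b \<Rightarrow> ennreal"
    using that by (simp add: nn_integral_0_iff_AE mu.AE_False)
  have G0: "G x \<noteq> 0" if x: "x \<in> ?S" for x
    unfolding G_def using Fm[OF x] insert.prems(2)[OF upd[OF x]] by (rule pos)
  have H0: "H x \<noteq> 0" if x: "x \<in> ?S" for x
    unfolding H_def
  proof (rule pos)
    show "inverse (F (x(i := y))) \<noteq> 0" for y
      using insert.prems(3)[OF upd[OF x], of y] by (simp del: fun_upd_apply)
  qed (use Fm[OF x] in measurable)
  (* H is positive and G * H is bounded, so the Lipschitz bound already forces G to be finite. *)
  have Gfin: "G x \<noteq> \<infinity>" if x: "x \<in> ?S" for x
    using GH[OF x] H0[OF x] by (auto simp: ennreal_top_mult top_unique)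
  have Hle: "H x \<le> ennreal b * inverse (G x)" if x: "x \<in> ?S" for x
  proof -
    have "H x = (G x * H x) / G x"
      using ennreal_mult_divide_eq[of "G x" "H x"] G0[OF x] Gfin[OF x]
      by (simp add: mult.commute[of "G x"])
    also have "\<dots> \<le> ennreal b / G x" using GH[OF x] by (rule divide_right_mono_ennreal)
    finally show ?thesis by (simp add: divide_ennreal_def)
  qed
  have lipG: "G x \<le> ennreal (exp (\<kappa> * (\<Sum>j\<in>I. norm (x j - x' j)))) * G x'"
    if x: "x \<in> ?S" and x': "x' \<in> ?S" for x x'
  proof -
    have "F (x(i := y)) \<le> ennreal (exp (\<kappa> * (\<Sum>j\<in>I. norm (x j - x' j)))) * F (x'(i := y))" for y
    proof -
      have eq: "(\<Sum>j\<in>insert i I. norm ((x(i := y)) j - (x'(i := y)) j)) = (\<Sum>j\<in>I. norm (x j - x' j))"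
        using insert.hyps by (auto intro!: sum.cong)
      then show ?thesis using insert.prems(4)[OF upd[OF x, of y] upd[OF x', of y]] by (simp only: eq)
    qed
    then have "G x \<le> (\<integral>\<^sup>+y. ennreal (exp (\<kappa> * (\<Sum>j\<in>I. norm (x j - x' j)))) * F (x'(i := y)) \<partial>\<mu>)"
      unfolding G_def by (intro nn_integral_mono)
    then show ?thesis using Fm[OF x'] by (simp add: G_def nn_integral_cmult)
  qed
  have "(\<integral>\<^sup>+x. F x \<partial>Pi\<^sub>M (insert i I) (\<lambda>_. \<mu>)) * (\<integral>\<^sup>+x. inverse (F x) \<partial>Pi\<^sub>M (insert i I) (\<lambda>_. \<mu>))
    = (\<integral>\<^sup>+x. G x \<partial>Pi\<^sub>M I (\<lambda>_. \<mu>)) * (\<integral>\<^sup>+x. H x \<partial>Pi\<^sub>M I (\<lambda>_. \<mu>))"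
    unfolding G_def H_def using insert.hyps by (simp add: P.product_nn_integral_insert)
  also have "\<dots> \<le> (\<integral>\<^sup>+x. G x \<partial>Pi\<^sub>M I (\<lambda>_. \<mu>)) * (\<integral>\<^sup>+x. ennreal b * inverse (G x) \<partial>Pi\<^sub>M I (\<lambda>_. \<mu>))"
    by (intro mult_left_mono nn_integral_mono Hle) auto
  also have "\<dots> = ennreal b * ((\<integral>\<^sup>+x. G x \<partial>Pi\<^sub>M I (\<lambda>_. \<mu>)) * (\<integral>\<^sup>+x. inverse (G x) \<partial>Pi\<^sub>M I (\<lambda>_. \<mu>)))"
    by (simp add: nn_integral_cmult mult_ac)
  also have "\<dots> \<le> ennreal b * ennreal b ^ card I"
    by (intro mult_left_mono insert.IH Gm G0 Gfin lipG) auto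
  finally show ?case using insert.hyps by simp
qed

text \<open>
  Multiplying a centred normal density by \<open>exp (\<kappa>\<^sup>2 x\<^sup>2)\<close> only changes its variance: it is a multiple,
  by \<open>1 / sqrt (1 - u)\<close> with \<open>u = 2 \<kappa>\<^sup>2 \<tau>\<^sup>2\<close>, of the normal density with variance \<open>\<tau>\<^sup>2 / (1 - u)\<close>.
\<close>

lemma nn_integral_exp_square_gaussian:
  fixes \<kappa> \<tau> :: real
  assumes "0 < \<tau>" and small: "4 * \<kappa>\<^sup>2 * \<tau>\<^sup>2 \<le> 1"
  shows "(\<integral>\<^sup>+x. ennreal (normal_density 0 \<tau> x * exp (\<kappa>\<^sup>2 * x\<^sup>2)) \<partial>lborel) \<le> ennreal (exp (2 * \<kappa>\<^sup>2 * \<tau>\<^sup>2))"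
proof -
  define u where "u = 2 * \<kappa>\<^sup>2 * \<tau>\<^sup>2"
  have u: "0 \<le> u" "u \<le> 1 / 2" using small by (auto simp: u_def)
  define \<rho> where "\<rho> = \<tau> / sqrt (1 - u)"
  have \<rho>: "0 < \<rho>" using u assms by (simp add: \<rho>_def)
  have \<rho>2: "\<rho>\<^sup>2 = \<tau>\<^sup>2 / (1 - u)" using u by (simp add: \<rho>_def power_divide)
  have eq: "normal_density 0 \<tau> x * exp (\<kappa>\<^sup>2 * x\<^sup>2) = 1 / sqrt (1 - u) * normal_density 0 \<rho> x" for x
  proof -
    have "- x\<^sup>2 / (2 * \<tau>\<^sup>2) + \<kappa>\<^sup>2 * x\<^sup>2 = - x\<^sup>2 / (2 * \<rho>\<^sup>2)"
      using assms u unfolding \<rho>2 by (simp add: u_def field_simps)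
    then have "exp (- x\<^sup>2 / (2 * \<tau>\<^sup>2)) * exp (\<kappa>\<^sup>2 * x\<^sup>2) = exp (- x\<^sup>2 / (2 * \<rho>\<^sup>2))"
      by (simp flip: exp_add)
    moreover have "1 / sqrt (2 * pi * \<tau>\<^sup>2) = 1 / sqrt (1 - u) * (1 / sqrt (2 * pi * \<rho>\<^sup>2))"
      using assms u unfolding \<rho>2 by (simp add: real_sqrt_divide real_sqrt_mult)
    ultimately show ?thesis
      by (simp add: normal_density_def)
  qed
  have "(\<integral>\<^sup>+x. ennreal (normal_density 0 \<tau> x * exp (\<kappa>\<^sup>2 * x\<^sup>2)) \<partial>lborel)
      = (\<integral>\<^sup>+x. ennreal (1 / sqrt (1 - u)) * ennreal (normal_density 0 \<rho> x) \<partial>lborel)"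
    using u by (intro nn_integral_cong) (simp add: eq flip: ennreal_mult')
  also have "\<dots> = ennreal (1 / sqrt (1 - u)) * 1"
    using \<rho> by (subst nn_integral_cmult) (auto simp: nn_integral_eq_integral)
  also have "\<dots> \<le> ennreal (exp u)"
  proof -
    have "1 \<le> (1 - u) * (1 + 2 * u)"
      using mult_nonneg_nonneg[OF u(1), of "1 - 2 * u"] u(2) by (simp add: algebra_simps)
    also have "\<dots> \<le> (1 - u) * exp (2 * u)"
      using exp_ge_add_one_self[of "2 * u"] u by (intro mult_left_mono) auto
    finally have "sqrt 1 \<le> sqrt ((1 - u) * (exp u)\<^sup>2)"
      by (simp add: exp_double)
    then have "1 \<le> sqrt (1 - u) * exp u"
      by (simp add: real_sqrt_mult)
    then show ?thesis using u by (simp add: field_simps)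
  qed
  finally show ?thesis by (simp add: u_def)
qed

text \<open>
  By \<open>cosh a \<le> exp (a\<^sup>2 / 2)\<close> and \<open>|y - y'|\<^sup>2 \<le> 2 |y|\<^sup>2 + 2 |y'|\<^sup>2\<close> the double integral separates into a
  product of one-dimensional Gaussian integrals.  With \<open>\<tau>\<^sup>2 = 1 / n\<close> the bound has an \<open>n\<close>-th power that
  does not depend on \<open>n\<close>.
\<close>

lemma gaussian_cosh_moment:
  fixes \<kappa> \<tau> :: real
  defines "\<mu> \<equiv> density lborel (\<lambda>y::'b::euclidean_space. ennreal (\<Prod>b\<in>Basis. normal_density 0 \<tau> (y \<bullet> b)))"
  assumes "0 < \<tau>" and small: "4 * \<kappa>\<^sup>2 * \<tau>\<^sup>2 \<le> 1"
  shows "(\<integral>\<^sup>+y. \<integral>\<^sup>+y'. ennreal (cosh (\<kappa> * norm (y - y'))) \<partial>\<mu> \<partial>\<mu>)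
    \<le> ennreal (exp (4 * DIM('b) * \<kappa>\<^sup>2 * \<tau>\<^sup>2))"
proof -
  have sets[measurable_cong]: "sets \<mu> = sets borel" by (simp add: \<mu>_def)
  have pt: "ennreal (cosh (\<kappa> * norm (y - y')))
      \<le> ennreal (exp (\<kappa>\<^sup>2 * (norm y)\<^sup>2)) * ennreal (exp (\<kappa>\<^sup>2 * (norm y')\<^sup>2))" for y y' :: 'b
  proof -
    have "(norm (y - y'))\<^sup>2 \<le> (norm y + norm y')\<^sup>2"
      by (intro power_mono norm_triangle_ineq4) auto
    also have "\<dots> \<le> 2 * (norm y)\<^sup>2 + 2 * (norm y')\<^sup>2"
      using sum_squares_bound[of "norm y" "norm y'"] by (simp add: power2_sum)
    finally have "\<kappa>\<^sup>2 * (norm (y - y'))\<^sup>2 \<le> \<kappa>\<^sup>2 * (2 * (norm y)\<^sup>2 + 2 * (norm y')\<^sup>2)"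
      by (rule mult_left_mono) auto
    then have "(\<kappa> * norm (y - y'))\<^sup>2 / 2 \<le> \<kappa>\<^sup>2 * (norm y)\<^sup>2 + \<kappa>\<^sup>2 * (norm y')\<^sup>2"
      by (simp add: power_mult_distrib algebra_simps)
    then have "exp ((\<kappa> * norm (y - y'))\<^sup>2 / 2) \<le> exp (\<kappa>\<^sup>2 * (norm y)\<^sup>2) * exp (\<kappa>\<^sup>2 * (norm y')\<^sup>2)"
      by (simp flip: exp_add)
    from order_trans[OF cosh_real_le_exp_half_square this] show ?thesis
      by (simp flip: ennreal_mult')
  qed
  define E where "E = (\<integral>\<^sup>+y. ennreal (exp (\<kappa>\<^sup>2 * (norm y)\<^sup>2)) \<partial>\<mu>)"
  have "E = (\<integral>\<^sup>+(y::'b). (\<Prod>b\<in>Basis. ennreal (normal_density 0 \<tau> (y \<bullet> b) * exp (\<kappa>\<^sup>2 * (y \<bullet> b)\<^sup>2))) \<partial>lborel)"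
    unfolding E_def \<mu>_def
  proof (subst nn_integral_density)
    show "(\<integral>\<^sup>+(y::'b). ennreal (\<Prod>b\<in>Basis. normal_density 0 \<tau> (y \<bullet> b)) * ennreal (exp (\<kappa>\<^sup>2 * (norm y)\<^sup>2)) \<partial>lborel)
      = (\<integral>\<^sup>+(y::'b). (\<Prod>b\<in>Basis. ennreal (normal_density 0 \<tau> (y \<bullet> b) * exp (\<kappa>\<^sup>2 * (y \<bullet> b)\<^sup>2))) \<partial>lborel)"
    proof (intro nn_integral_cong)
      fix y :: 'b
      have "exp (\<kappa>\<^sup>2 * (norm y)\<^sup>2) = (\<Prod>b\<in>Basis. exp (\<kappa>\<^sup>2 * (y \<bullet> b)\<^sup>2))"
        by (simp add: norm_eq_sqrt_inner euclidean_inner[of y y] sum_nonneg exp_sum[symmetric]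
            sum_distrib_left power2_eq_square)
      then show "ennreal (\<Prod>b\<in>Basis. normal_density 0 \<tau> (y \<bullet> b)) * ennreal (exp (\<kappa>\<^sup>2 * (norm y)\<^sup>2))
        = (\<Prod>b\<in>Basis. ennreal (normal_density 0 \<tau> (y \<bullet> b) * exp (\<kappa>\<^sup>2 * (y \<bullet> b)\<^sup>2)))"
        by (simp add: prod_ennreal prod.distrib prod_nonneg flip: ennreal_mult)
    qed
  qed auto
  also have "\<dots> = (\<Prod>b\<in>(Basis::'b set). \<integral>\<^sup>+x. ennreal (normal_density 0 \<tau> x * exp (\<kappa>\<^sup>2 * x\<^sup>2)) \<partial>lborel)"
    by (rule nn_integral_lborel_prod) auto
  also have "\<dots> \<le> ennreal (exp (2 * \<kappa>\<^sup>2 * \<tau>\<^sup>2)) ^ DIM('b)"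
    using nn_integral_exp_square_gaussian[OF assms(2) small]
    by (simp add: power_mono)
  also have "\<dots> = ennreal (exp (2 * DIM('b) * \<kappa>\<^sup>2 * \<tau>\<^sup>2))"
    by (simp add: ennreal_power exp_of_nat_mult[symmetric] mult_ac)
  finally have E: "E \<le> ennreal (exp (2 * DIM('b) * \<kappa>\<^sup>2 * \<tau>\<^sup>2))" .
  have "(\<integral>\<^sup>+y. \<integral>\<^sup>+y'. ennreal (cosh (\<kappa> * norm (y - y'))) \<partial>\<mu> \<partial>\<mu>)
    \<le> (\<integral>\<^sup>+y. \<integral>\<^sup>+y'. ennreal (exp (\<kappa>\<^sup>2 * (norm y)\<^sup>2)) * ennreal (exp (\<kappa>\<^sup>2 * (norm y')\<^sup>2)) \<partial>\<mu> \<partial>\<mu>)"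
    by (intro nn_integral_mono pt)
  also have "\<dots> = E * E"
    by (simp add: E_def nn_integral_cmult nn_integral_multc)
  also have "\<dots> \<le> ennreal (exp (2 * DIM('b) * \<kappa>\<^sup>2 * \<tau>\<^sup>2)) * ennreal (exp (2 * DIM('b) * \<kappa>\<^sup>2 * \<tau>\<^sup>2))"
    by (intro mult_mono E) auto
  also have "\<dots> = ennreal (exp (4 * DIM('b) * \<kappa>\<^sup>2 * \<tau>\<^sup>2))"
    by (simp flip: ennreal_mult' exp_add)
  finally show ?thesis .
qed

section \<open>From exponential moments to tails\<close>

text \<open>
  Fatou's lemma on the square of the space, applied to \<open>exp (X n \<omega> - X n \<omega>')\<close>.  The bound is on the product
  of the two moments, neither of which need be bounded along the sequence by itself, so Fatou's lemma is
  used for the two variables together.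
\<close>

lemma nn_integral_exp_times_exp_minus_limit:
  fixes X :: "nat \<Rightarrow> 'a \<Rightarrow> real"
  assumes X[measurable]: "\<And>n. X n \<in> borel_measurable M"
    and lim: "\<And>\<omega>. \<omega> \<in> space M \<Longrightarrow> (\<lambda>n. X n \<omega>) \<longlonglongrightarrow> Y \<omega>"
    and bound: "\<forall>\<^sub>F n in sequentially.
      (\<integral>\<^sup>+\<omega>. ennreal (exp (X n \<omega>)) \<partial>M) * (\<integral>\<^sup>+\<omega>. ennreal (exp (- X n \<omega>)) \<partial>M) \<le> B"
  shows "(\<integral>\<^sup>+\<omega>. ennreal (exp (Y \<omega>)) \<partial>M) * (\<integral>\<^sup>+\<omega>. ennreal (exp (- Y \<omega>)) \<partial>M) \<le> B"
proof -
  have [measurable]: "Y \<in> borel_measurable M"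
    by (rule borel_measurable_LIMSEQ_real[OF lim X])
  define A where "A n = (\<integral>\<^sup>+\<omega>. ennreal (exp (X n \<omega>)) \<partial>M)" for n
  define A' where "A' n = (\<integral>\<^sup>+\<omega>. ennreal (exp (- X n \<omega>)) \<partial>M)" for n
  have lim2: "(\<lambda>n. ennreal (exp (X n \<omega>)) * ennreal (exp (- X n \<omega>'))) \<longlonglongrightarrow>
      ennreal (exp (Y \<omega>)) * ennreal (exp (- Y \<omega>'))"
    if "\<omega> \<in> space M" "\<omega>' \<in> space M" for \<omega> \<omega>'
    using that unfolding ennreal_mult'[OF exp_ge_zero, symmetric]
    by (intro tendsto_ennrealI tendsto_intros lim)
  have "(\<integral>\<^sup>+\<omega>. ennreal (exp (Y \<omega>)) \<partial>M) * (\<integral>\<^sup>+\<omega>. ennreal (exp (- Y \<omega>)) \<partial>M)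
    = (\<integral>\<^sup>+\<omega>. \<integral>\<^sup>+\<omega>'. ennreal (exp (Y \<omega>)) * ennreal (exp (- Y \<omega>')) \<partial>M \<partial>M)"
    by (simp add: nn_integral_cmult nn_integral_multc)
  also have "\<dots> \<le> (\<integral>\<^sup>+\<omega>. liminf (\<lambda>n. ennreal (exp (X n \<omega>)) * A' n) \<partial>M)"
  proof (rule nn_integral_mono)
    fix \<omega> assume \<omega>: "\<omega> \<in> space M"
    have "(\<integral>\<^sup>+\<omega>'. ennreal (exp (Y \<omega>)) * ennreal (exp (- Y \<omega>')) \<partial>M)
      = (\<integral>\<^sup>+\<omega>'. liminf (\<lambda>n. ennreal (exp (X n \<omega>)) * ennreal (exp (- X n \<omega>'))) \<partial>M)"
      by (intro nn_integral_cong lim_imp_Liminf[symmetric] lim2 \<omega>) auto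
    also have "\<dots> \<le> liminf (\<lambda>n. \<integral>\<^sup>+\<omega>'. ennreal (exp (X n \<omega>)) * ennreal (exp (- X n \<omega>')) \<partial>M)"
      by (intro nn_integral_liminf) simp
    also have "\<dots> = liminf (\<lambda>n. ennreal (exp (X n \<omega>)) * A' n)"
      by (simp add: nn_integral_cmult A'_def)
    finally show "(\<integral>\<^sup>+\<omega>'. ennreal (exp (Y \<omega>)) * ennreal (exp (- Y \<omega>')) \<partial>M) \<le> \<dots>" .
  qed
  also have "\<dots> \<le> liminf (\<lambda>n. \<integral>\<^sup>+\<omega>. ennreal (exp (X n \<omega>)) * A' n \<partial>M)"
    by (intro nn_integral_liminf) simp
  also have "\<dots> = liminf (\<lambda>n. A n * A' n)"
    by (simp add: nn_integral_multc A_def)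
  also have "\<dots> \<le> B"
    using Liminf_mono[of "\<lambda>n. A n * A' n" "\<lambda>_. B" sequentially] bound
    by (simp add: A_def A'_def Liminf_const)
  finally show ?thesis .
qed

text \<open>
  The hypothesis is unchanged if a constant is added to \<open>X\<close>.  With \<open>X\<close> centred both exponential moments
  are at least \<open>1\<close>, so each is bounded by their product, and Markov's inequality applies to both tails.
\<close>

lemma (in prob_space) subgaussian_tail:
  fixes X :: "'a \<Rightarrow> real"
  assumes X[measurable]: "X \<in> borel_measurable M" and "0 < c"
    and bound: "\<And>\<kappa>. 0 < \<kappa> \<Longrightarrow>
      (\<integral>\<^sup>+\<omega>. ennreal (exp (\<kappa> * X \<omega>)) \<partial>M) * (\<integral>\<^sup>+\<omega>. ennreal (exp (- (\<kappa> * X \<omega>))) \<partial>M)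
        \<le> ennreal (exp (c * \<kappa>\<^sup>2))"
    and "0 < r"
  shows "measure M {\<omega> \<in> space M. \<bar>X \<omega> - expectation X\<bar> \<ge> r} \<le> 2 * exp (- (r\<^sup>2 / (4 * c)))"
proof -
  have pos: "(\<integral>\<^sup>+\<omega>. ennreal (exp (Y \<omega>)) \<partial>M) \<noteq> 0" if [measurable]: "Y \<in> borel_measurable M" for Y
    by (simp add: nn_integral_0_iff_AE AE_False)
  have int: "integrable M (\<lambda>\<omega>. exp (\<kappa> * X \<omega>))" "integrable M (\<lambda>\<omega>. exp (- (\<kappa> * X \<omega>)))"
    if "0 < \<kappa>" for \<kappa>
  proof -
    have "(\<integral>\<^sup>+\<omega>. ennreal (exp (\<kappa> * X \<omega>)) \<partial>M) * (\<integral>\<^sup>+\<omega>. ennreal (exp (- (\<kappa> * X \<omega>))) \<partial>M) < \<infinity>"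
      using bound[OF that] by (rule le_less_trans) simp
    with pos[of "\<lambda>\<omega>. \<kappa> * X \<omega>"] pos[of "\<lambda>\<omega>. - (\<kappa> * X \<omega>)"]
    have "(\<integral>\<^sup>+\<omega>. ennreal (exp (\<kappa> * X \<omega>)) \<partial>M) < \<infinity>" "(\<integral>\<^sup>+\<omega>. ennreal (exp (- (\<kappa> * X \<omega>))) \<partial>M) < \<infinity>"
      by (auto simp: ennreal_mult_less_top)
    then show "integrable M (\<lambda>\<omega>. exp (\<kappa> * X \<omega>))" "integrable M (\<lambda>\<omega>. exp (- (\<kappa> * X \<omega>)))"
      by (auto intro!: integrableI_nonneg)
  qed
  have intX: "integrable M X"
  proof (rule Bochner_Integration.integrable_bound)
    show "integrable M (\<lambda>\<omega>. exp (1 * X \<omega>) + exp (- (1 * X \<omega>)))"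
      by (intro Bochner_Integration.integrable_add int) auto
    show "AE \<omega> in M. norm (X \<omega>) \<le> norm (exp (1 * X \<omega>) + exp (- (1 * X \<omega>)))"
    proof (intro AE_I2)
      fix \<omega>
      show "norm (X \<omega>) \<le> norm (exp (1 * X \<omega>) + exp (- (1 * X \<omega>)))"
        using exp_ge_add_one_self[of "X \<omega>"] exp_ge_add_one_self[of "- X \<omega>"]
          exp_gt_zero[of "X \<omega>"] exp_gt_zero[of "- X \<omega>"]
        unfolding real_norm_def mult_1 by linarith
    qed
  qed simp
  define m where "m = expectation X"
  (* This value minimises c * \<kappa>\<^sup>2 - \<kappa> * r. *)
  define \<kappa> where "\<kappa> = r / (2 * c)"
  have \<kappa>: "0 < \<kappa>" using assms by (simp add: \<kappa>_def)
  define P where "P = expectation (\<lambda>\<omega>. exp (\<kappa> * (X \<omega> - m)))"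
  define Q where "Q = expectation (\<lambda>\<omega>. exp (- (\<kappa> * (X \<omega> - m))))"
  have eP: "exp (\<kappa> * (X \<omega> - m)) = exp (- (\<kappa> * m)) * exp (\<kappa> * X \<omega>)" for \<omega>
    by (simp add: algebra_simps flip: exp_add)
  have eQ: "exp (- (\<kappa> * (X \<omega> - m))) = exp (\<kappa> * m) * exp (- (\<kappa> * X \<omega>))" for \<omega>
    by (simp add: algebra_simps flip: exp_add)
  have intP: "integrable M (\<lambda>\<omega>. exp (\<kappa> * (X \<omega> - m)))"
    and intQ: "integrable M (\<lambda>\<omega>. exp (- (\<kappa> * (X \<omega> - m))))"
    unfolding eP eQ using int[OF \<kappa>] by auto
  have P1: "1 \<le> P"
  proof -
    have "1 = expectation (\<lambda>\<omega>. 1 + \<kappa> * (X \<omega> - m))"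
      using intX by (simp add: m_def prob_space)
    also have "\<dots> \<le> P" unfolding P_def
      using intX intP by (intro integral_mono) auto
    finally show ?thesis .
  qed
  have Q1: "1 \<le> Q"
  proof -
    have "1 = expectation (\<lambda>\<omega>. 1 + (- (\<kappa> * (X \<omega> - m))))"
      using intX by (simp add: m_def prob_space)
    also have "\<dots> \<le> Q" unfolding Q_def
      using intX intQ by (intro integral_mono exp_ge_add_one_self) auto
    finally show ?thesis .
  qed
  have PQ: "P * Q \<le> exp (c * \<kappa>\<^sup>2)"
  proof -
    have "ennreal (expectation (\<lambda>\<omega>. exp (\<kappa> * X \<omega>)) * expectation (\<lambda>\<omega>. exp (- (\<kappa> * X \<omega>))))
        \<le> ennreal (exp (c * \<kappa>\<^sup>2))"
      using bound[OF \<kappa>] int[OF \<kappa>]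
      by (simp add: nn_integral_eq_integral ennreal_mult' integral_nonneg_AE)
    then have "expectation (\<lambda>\<omega>. exp (\<kappa> * X \<omega>)) * expectation (\<lambda>\<omega>. exp (- (\<kappa> * X \<omega>))) \<le> exp (c * \<kappa>\<^sup>2)"
      by simp
    moreover have "exp (- (\<kappa> * m)) * exp (\<kappa> * m) = 1"
      by (simp flip: exp_add)
    moreover have "P = exp (- (\<kappa> * m)) * expectation (\<lambda>\<omega>. exp (\<kappa> * X \<omega>))"
      unfolding P_def eP by simp
    moreover have "Q = exp (\<kappa> * m) * expectation (\<lambda>\<omega>. exp (- (\<kappa> * X \<omega>)))"
      unfolding Q_def eQ by simp
    moreover have "(e * A) * (e' * B) = (e * e') * (A * B)" for e e' A B :: real
      by algebra
    ultimately show ?thesis by (metis mult_1)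
  qed
  have PB: "P \<le> exp (c * \<kappa>\<^sup>2)"
  proof -
    have "P * 1 \<le> P * Q" using P1 Q1 by (intro mult_left_mono) auto
    then show ?thesis using PQ by linarith
  qed
  have QB: "Q \<le> exp (c * \<kappa>\<^sup>2)"
  proof -
    have "1 * Q \<le> P * Q" using P1 Q1 by (intro mult_right_mono) auto
    then show ?thesis using PQ by linarith
  qed
  have upper: "prob {\<omega> \<in> space M. r \<le> X \<omega> - m} \<le> exp (- (\<kappa> * r)) * P"
  proof -
    have "prob {\<omega> \<in> space M. r \<le> X \<omega> - m} = prob {\<omega> \<in> space M. exp (\<kappa> * r) \<le> exp (\<kappa> * (X \<omega> - m))}"
      using \<kappa> by simp
    also have "\<dots> \<le> P / exp (\<kappa> * r)"
      unfolding P_def by (rule integral_Markov_inequality_measure[OF intP, of "{}"]) auto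
    finally show ?thesis by (simp add: exp_minus field_simps)
  qed
  have lower: "prob {\<omega> \<in> space M. r \<le> m - X \<omega>} \<le> exp (- (\<kappa> * r)) * Q"
  proof -
    have "prob {\<omega> \<in> space M. r \<le> m - X \<omega>} = prob {\<omega> \<in> space M. exp (\<kappa> * r) \<le> exp (- (\<kappa> * (X \<omega> - m)))}"
      using \<kappa> by (simp flip: mult_minus_right)
    also have "\<dots> \<le> Q / exp (\<kappa> * r)"
      unfolding Q_def by (rule integral_Markov_inequality_measure[OF intQ, of "{}"]) auto
    finally show ?thesis by (simp add: exp_minus field_simps)
  qed
  have expo: "exp (- (\<kappa> * r)) * exp (c * \<kappa>\<^sup>2) = exp (- (r\<^sup>2 / (4 * c)))"
    using \<open>0 < c\<close> by (simp add: \<kappa>_def power2_eq_square field_simps flip: exp_add)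
  have "{\<omega> \<in> space M. \<bar>X \<omega> - m\<bar> \<ge> r}
      \<subseteq> {\<omega> \<in> space M. r \<le> X \<omega> - m} \<union> {\<omega> \<in> space M. r \<le> m - X \<omega>}"
    by auto
  then have "prob {\<omega> \<in> space M. \<bar>X \<omega> - m\<bar> \<ge> r}
      \<le> prob ({\<omega> \<in> space M. r \<le> X \<omega> - m} \<union> {\<omega> \<in> space M. r \<le> m - X \<omega>})"
    by (intro finite_measure_mono) auto
  also have "\<dots> \<le> prob {\<omega> \<in> space M. r \<le> X \<omega> - m} + prob {\<omega> \<in> space M. r \<le> m - X \<omega>}"
    by (rule measure_Un_le) auto
  also have "\<dots> \<le> exp (- (\<kappa> * r)) * exp (c * \<kappa>\<^sup>2) + exp (- (\<kappa> * r)) * exp (c * \<kappa>\<^sup>2)"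
    using upper lower PB QB by (intro add_mono) (auto elim!: order_trans intro!: mult_left_mono)
  finally show ?thesis unfolding expo m_def by simp
qed

section \<open>The kernel and its derivative\<close>

definition conga_kernel :: "real \<Rightarrow> real \<Rightarrow> real \<Rightarrow> real \<Rightarrow> real" where
  "conga_kernel a s x z =
    1 / sqrt (2 * pi) * ((x + a * z) / (2 * s * z powr (3/2))) * exp (- ((x - a * z)\<^sup>2 / (2 * s\<^sup>2 * z)))"

text \<open>
  The density of \<open>a z + s B z\<close> for a one-dimensional Brownian motion \<open>B\<close>.  At \<open>z = 0\<close> it takes the value
  \<open>0\<close>, which is its limit as \<open>z\<close> tends to \<open>0\<close> for every \<open>x > 0\<close>.
\<close>

definition drift_density :: "real \<Rightarrow> real \<Rightarrow> real \<Rightarrow> real \<Rightarrow> real" where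
  "drift_density a s x z = normal_density (a * z) (s * sqrt z) x"

text \<open>
  Both the \<open>x\<close>-derivative of \<open>conga_kernel\<close> and minus the \<open>z\<close>-derivative of \<open>drift_density\<close>.
\<close>

definition conga_kernel_deriv :: "real \<Rightarrow> real \<Rightarrow> real \<Rightarrow> real \<Rightarrow> real" where
  "conga_kernel_deriv a s x z =
    drift_density a s x z * (1 / (2 * z) - (x\<^sup>2 - a\<^sup>2 * z\<^sup>2) / (2 * s\<^sup>2 * z\<^sup>2))"

lemma drift_density_0 [simp]: "drift_density a s x 0 = 0"
  by (simp add: drift_density_def normal_density_def)

lemma drift_density_nonneg: "0 \<le> drift_density a s x z"
  by (simp add: drift_density_def)

lemma drift_density_eq:
  assumes "0 < s" "0 < z"
  shows "drift_density a s x z = 1 / (sqrt (2 * pi) * s) * (1 / sqrt z) * exp (- ((x - a * z)\<^sup>2 / (2 * s\<^sup>2 * z)))"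
  using assms by (simp add: drift_density_def normal_density_def power_mult_distrib real_sqrt_mult mult_ac)

lemma conga_kernel_eq:
  assumes "0 < s" "0 \<le> z"
  shows "conga_kernel a s x z = (x + a * z) / (2 * z) * drift_density a s x z"
proof (cases "z = 0")
  case False
  have "z powr (3/2) = z powr (1 + 1/2)" by simp
  also have "\<dots> = z * sqrt z"
    using assms False by (simp only: powr_add) (simp add: powr_half_sqrt)
  finally show ?thesis
    using assms False by (simp add: conga_kernel_def drift_density_eq field_simps)
qed (simp add: conga_kernel_def)

lemma has_real_derivative_conga_kernel:
  assumes "0 < s" "0 < z"
  shows "((\<lambda>x. conga_kernel a s x z) has_real_derivative conga_kernel_deriv a s x z) (at x)"
proof -
  define c where "c = 1 / (sqrt (2 * pi) * s) * (1 / sqrt z)"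
  have dens: "drift_density a s u z = c * exp (- ((u - a * z)\<^sup>2 / (2 * s\<^sup>2 * z)))" for u
    using assms by (simp add: c_def drift_density_eq)
  have d1: "((\<lambda>x. (x + a * z) / (2 * z)) has_real_derivative 1 / (2 * z)) (at x)"
    using assms by (auto intro!: derivative_eq_intros)
  have d2: "((\<lambda>x. - ((x - a * z)\<^sup>2 / (2 * s\<^sup>2 * z))) has_real_derivative
      - ((x - a * z) / (s\<^sup>2 * z))) (at x)"
    using assms by (auto intro!: derivative_eq_intros simp: field_simps)
  have "((\<lambda>x. (x + a * z) / (2 * z) * drift_density a s x z) has_real_derivative
      drift_density a s x z * (1 / (2 * z) + (x + a * z) / (2 * z) * (- ((x - a * z) / (s\<^sup>2 * z))))) (at x)"
    unfolding dens
  proof (rule DERIV_cong[OF DERIV_mult[OF d1 DERIV_cmult[OF DERIV_fun_exp[OF d2]]]])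
    show "A * (c * E) + c * (E * B) * L = c * E * (A + L * B)" for A B E L :: real
      by algebra
  qed
  moreover have "1 / (2 * z) + (x + a * z) / (2 * z) * (- ((x - a * z) / (s\<^sup>2 * z)))
      = 1 / (2 * z) - (x\<^sup>2 - a\<^sup>2 * z\<^sup>2) / (2 * s\<^sup>2 * z\<^sup>2)"
    using assms by (simp add: field_simps power2_eq_square)
  ultimately show ?thesis
    using assms by (simp add: conga_kernel_eq conga_kernel_deriv_def)
qed

lemma has_real_derivative_drift_density:
  assumes "0 < s" "0 < z"
  shows "((\<lambda>z. drift_density a s x z) has_real_derivative - conga_kernel_deriv a s x z) (at z)"
proof -
  define f where "f z = 1 / (sqrt (2 * pi) * s) * (1 / sqrt z) * exp (- ((x - a * z)\<^sup>2 / (2 * s\<^sup>2 * z)))" for z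
  have d1: "((\<lambda>z. 1 / sqrt z) has_real_derivative (1 / sqrt z) * (- (1 / (2 * z)))) (at z)"
    using assms by (auto intro!: derivative_eq_intros simp: field_simps)
  have d2: "((\<lambda>z. - ((x - a * z)\<^sup>2 / (2 * s\<^sup>2 * z))) has_real_derivative
      (x\<^sup>2 - a\<^sup>2 * z\<^sup>2) / (2 * s\<^sup>2 * z\<^sup>2)) (at z)"
    using assms by (auto intro!: derivative_eq_intros simp: field_simps power2_eq_square)
  have "(f has_real_derivative f z * (- (1 / (2 * z)) + (x\<^sup>2 - a\<^sup>2 * z\<^sup>2) / (2 * s\<^sup>2 * z\<^sup>2))) (at z)"
    unfolding f_def
  proof (rule DERIV_cong[OF DERIV_mult[OF DERIV_cmult[OF d1] DERIV_fun_exp[OF d2]]])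
    show "c * (q * - h) * E + E * B * (c * q) = c * q * E * (- h + B)" for c q h E B :: real
      by algebra
  qed
  moreover have "f z * (- (1 / (2 * z)) + (x\<^sup>2 - a\<^sup>2 * z\<^sup>2) / (2 * s\<^sup>2 * z\<^sup>2)) = - conga_kernel_deriv a s x z"
  proof -
    have fz: "f z = drift_density a s x z" using assms by (simp add: f_def drift_density_eq)
    show ?thesis
      unfolding fz conga_kernel_deriv_def by (simp only: minus_mult_right minus_diff_eq) simp
  qed
  ultimately have "(f has_real_derivative - conga_kernel_deriv a s x z) (at z)" by simp
  then show ?thesis
    by (rule DERIV_cong_ev[THEN iffD1, rotated -1])
       (use assms in \<open>auto simp: f_def drift_density_eq
         intro!: eventually_mono[OF eventually_nhds_in_open[of "{0<..}" z]]\<close>)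
qed

lemma exp_minus_le_cube:
  fixes y :: real
  assumes "0 < y"
  shows "exp (- y) \<le> 27 / y ^ 3"
proof -
  have "(1 + y / real 3) ^ 3 \<le> exp y"
    using assms by (intro exp_ge_one_plus_x_over_n_power_n) auto
  moreover have "(y / 3) ^ 3 \<le> (1 + y / real 3) ^ 3"
    using assms by (intro power_mono) auto
  ultimately have "(y / 3) ^ 3 \<le> exp y" by linarith
  then show ?thesis using assms by (simp add: exp_minus field_simps)
qed

text \<open>
  For fixed \<open>x > 0\<close> the density vanishes as \<open>z\<close> tends to \<open>0\<close> faster than every power of \<open>z\<close>, because of the factor
  \<open>exp (- y)\<close> with \<open>y = x\<^sup>2 / (2 s\<^sup>2 z)\<close>.  Bounding this factor by the third power \<open>27 / y\<^sup>3\<close> is enough: it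
  makes up for the singularity \<open>z powr (- 5/2)\<close> of \<open>drift_density / z\<^sup>2\<close> and leaves \<open>sqrt z\<close>.
\<close>

definition decay_const :: "real \<Rightarrow> real \<Rightarrow> real \<Rightarrow> real" where
  "decay_const a s x = 216 * s ^ 6 / x ^ 6 * exp (a * x / s\<^sup>2) / (sqrt (2 * pi) * s)"

lemma drift_density_decay:
  assumes "0 < s" "0 < x" "0 < z"
  shows "drift_density a s x z / z\<^sup>2 \<le> decay_const a s x * sqrt z"
proof -
  define y where "y = x\<^sup>2 / (2 * s\<^sup>2 * z)"
  have y: "0 < y" using assms by (simp add: y_def)
  have "- ((x - a * z)\<^sup>2 / (2 * s\<^sup>2 * z)) = - y + a * x / s\<^sup>2 - a\<^sup>2 * z / (2 * s\<^sup>2)"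
    using assms by (simp add: y_def field_simps power2_eq_square)
  also have "\<dots> \<le> - y + a * x / s\<^sup>2" using assms by simp
  finally have "exp (- ((x - a * z)\<^sup>2 / (2 * s\<^sup>2 * z))) \<le> exp (- y) * exp (a * x / s\<^sup>2)"
    by (simp flip: exp_add)
  also have "\<dots> \<le> 27 / y ^ 3 * exp (a * x / s\<^sup>2)"
    by (intro mult_right_mono exp_minus_le_cube y) simp
  also have "27 / y ^ 3 = 216 * s ^ 6 / x ^ 6 * z ^ 3"
    using assms by (simp add: y_def field_simps power_mult_distrib)
  finally have e: "exp (- ((x - a * z)\<^sup>2 / (2 * s\<^sup>2 * z))) \<le> 216 * s ^ 6 / x ^ 6 * z ^ 3 * exp (a * x / s\<^sup>2)" .
  have "drift_density a s x z / z\<^sup>2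
      \<le> 1 / (sqrt (2 * pi) * s) * (1 / sqrt z) * (216 * s ^ 6 / x ^ 6 * z ^ 3 * exp (a * x / s\<^sup>2)) / z\<^sup>2"
    unfolding drift_density_eq[OF assms(1,3)] using assms
    by (intro divide_right_mono mult_left_mono e) auto
  also have "\<dots> = decay_const a s x * (z / sqrt z)"
    using assms by (simp add: decay_const_def field_simps power2_eq_square power3_eq_cube)
  also have "z / sqrt z = sqrt z" by (simp add: real_div_sqrt assms less_imp_le)
  finally show ?thesis .
qed

lemma decay_const_pos: "0 < s \<Longrightarrow> 0 < x \<Longrightarrow> 0 < decay_const a s x"
  by (simp add: decay_const_def)

lemma conga_kernel_deriv_decay:
  assumes "0 < s" "0 < x" "0 \<le> z" "z \<le> 1"
  shows "\<bar>conga_kernel_deriv a s x z\<bar>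
    \<le> decay_const a s x * (1 / 2 + (x\<^sup>2 + a\<^sup>2) / (2 * s\<^sup>2)) * sqrt z"
proof (cases "z = 0")
  case False
  then have z: "0 < z" using assms by simp
  have "z\<^sup>2 \<le> 1" "z\<^sup>2 \<le> z" using z assms by (auto simp: power2_eq_square mult_le_one)
  have eq: "1 / (2 * z) - (x\<^sup>2 - a\<^sup>2 * z\<^sup>2) / (2 * s\<^sup>2 * z\<^sup>2)
      = (z / 2 - (x\<^sup>2 - a\<^sup>2 * z\<^sup>2) / (2 * s\<^sup>2)) / z\<^sup>2"
    using z assms by (simp add: field_simps power2_eq_square)
  have "\<bar>z / 2 - (x\<^sup>2 - a\<^sup>2 * z\<^sup>2) / (2 * s\<^sup>2)\<bar> \<le> \<bar>z / 2\<bar> + \<bar>x\<^sup>2 - a\<^sup>2 * z\<^sup>2\<bar> / (2 * s\<^sup>2)"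
    by (rule order_trans[OF abs_triangle_ineq4]) (simp add: abs_divide)
  also have "\<dots> \<le> 1 / 2 + (x\<^sup>2 + a\<^sup>2) / (2 * s\<^sup>2)"
  proof (intro add_mono divide_right_mono)
    have "a\<^sup>2 * z\<^sup>2 \<le> a\<^sup>2 * 1" by (intro mult_left_mono \<open>z\<^sup>2 \<le> 1\<close>) auto
    then show "\<bar>x\<^sup>2 - a\<^sup>2 * z\<^sup>2\<bar> \<le> x\<^sup>2 + a\<^sup>2" by (simp add: abs_le_iff add_increasing2 add_increasing)
  qed (use z assms in auto)
  finally have b: "\<bar>z / 2 - (x\<^sup>2 - a\<^sup>2 * z\<^sup>2) / (2 * s\<^sup>2)\<bar> \<le> 1 / 2 + (x\<^sup>2 + a\<^sup>2) / (2 * s\<^sup>2)" .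
  have "\<bar>conga_kernel_deriv a s x z\<bar>
      = drift_density a s x z / z\<^sup>2 * \<bar>z / 2 - (x\<^sup>2 - a\<^sup>2 * z\<^sup>2) / (2 * s\<^sup>2)\<bar>"
    unfolding conga_kernel_deriv_def eq
    using drift_density_nonneg[of a s x z] by (simp add: abs_mult abs_divide)
  also have "\<dots> \<le> (decay_const a s x * sqrt z) * (1 / 2 + (x\<^sup>2 + a\<^sup>2) / (2 * s\<^sup>2))"
    using drift_density_decay[OF assms(1,2) z] b decay_const_pos[OF assms(1,2), of a] z
    by (intro mult_mono) (auto intro: mult_nonneg_nonneg)
  finally show ?thesis by (simp add: mult_ac)
qed (simp add: conga_kernel_deriv_def)

text \<open>
  The formulas for the kernels are continuous only for \<open>z > 0\<close>; the decay bounds extend continuity to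
  the boundary \<open>z = 0\<close>, where division by zero makes their values \<open>0\<close>.
\<close>

lemma continuous_on_times_closed_interval:
  fixes g :: "real \<times> real \<Rightarrow> real"
  assumes g: "continuous_on ({0<..} \<times> {0<..}) g" and c: "continuous_on {0<..} c"
    and bound: "\<And>x z. 0 < x \<Longrightarrow> 0 \<le> z \<Longrightarrow> z \<le> 1 \<Longrightarrow> \<bar>g (x, z)\<bar> \<le> c x * sqrt z"
  shows "continuous_on ({0<..} \<times> {0..1}) g"
  unfolding continuous_on_eq_continuous_within
proof
  fix p :: "real \<times> real" assume p: "p \<in> {0<..} \<times> {0..1}"
  obtain x z where xz: "p = (x, z)" "0 < x" "0 \<le> z" "z \<le> 1" using p by auto
  show "continuous (at p within {0<..} \<times> {0..1}) g"
  proof (cases "z = 0")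
    case False
    then have "p \<in> {0<..} \<times> {0<..}" using xz by auto
    moreover have "open ({0<..} \<times> {0<..} :: (real \<times> real) set)" by (intro open_Times) auto
    ultimately have "continuous (at p) g" using g continuous_on_eq_continuous_at by blast
    then show ?thesis by (rule continuous_at_imp_continuous_at_within)
  next
    case True
    let ?F = "at p within {0<..} \<times> {0..1}"
    have "continuous_on ({0<..} \<times> {0..1}) (\<lambda>q. c (fst q) * sqrt (snd q))"
      by (intro continuous_intros continuous_on_compose2[OF c]) auto
    then have "((\<lambda>q. c (fst q) * sqrt (snd q)) \<longlongrightarrow> c (fst p) * sqrt (snd p)) ?F"
      using p unfolding continuous_on_def by blast
    then have "((\<lambda>q. c (fst q) * sqrt (snd q)) \<longlongrightarrow> 0) ?F"
      using xz True by simp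
    moreover have "\<forall>\<^sub>F q in ?F. norm (g q) \<le> c (fst q) * sqrt (snd q)"
      by (auto simp: eventually_at_filter intro!: always_eventually bound)
    ultimately have "(g \<longlongrightarrow> 0) ?F" by (rule Lim_null_comparison[rotated])
    moreover have "g p = 0" using bound[of x z] xz True by simp
    ultimately show ?thesis by (simp add: continuous_within)
  qed
qed

lemma continuous_on_decay_const: "0 < s \<Longrightarrow> continuous_on {0<..} (decay_const a s)"
  unfolding decay_const_def by (intro continuous_intros) auto

lemma continuous_on_drift_density_open:
  assumes "0 < s"
  shows "continuous_on ({0<..} \<times> {0<..}) (\<lambda>(x, z). drift_density a s x z)"
proof -
  have "continuous_on ({0<..} \<times> {0<..}) (\<lambda>p::real \<times> real. 1 / (sqrt (2 * pi) * s) * (1 / sqrt (snd p))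
      * exp (- ((fst p - a * snd p)\<^sup>2 / (2 * s\<^sup>2 * snd p))))"
    using assms by (intro continuous_intros) auto
  then show ?thesis
    by (rule continuous_on_eq) (use assms in \<open>auto simp: drift_density_eq\<close>)
qed

lemma continuous_on_conga_kernel_deriv:
  assumes "0 < s"
  shows "continuous_on ({0<..} \<times> {0..1}) (\<lambda>(x, z). conga_kernel_deriv a s x z)"
proof (rule continuous_on_times_closed_interval)
  show "continuous_on ({0<..} \<times> {0<..}) (\<lambda>(x, z). conga_kernel_deriv a s x z)"
    unfolding conga_kernel_deriv_def case_prod_unfold
    using continuous_on_drift_density_open[OF assms, of a] assms
    by (intro continuous_intros) (auto simp: case_prod_unfold)
  show "continuous_on {0<..} (\<lambda>x. decay_const a s x * (1 / 2 + (x\<^sup>2 + a\<^sup>2) / (2 * s\<^sup>2)))"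
    using assms by (intro continuous_intros continuous_on_decay_const) auto
qed (use conga_kernel_deriv_decay[OF assms] in auto)

lemma continuous_on_drift_density:
  assumes "0 < s"
  shows "continuous_on ({0<..} \<times> {0..1}) (\<lambda>(x, z). drift_density a s x z)"
proof (rule continuous_on_times_closed_interval[OF continuous_on_drift_density_open continuous_on_decay_const])
  fix x z :: real assume xz: "0 < x" "0 \<le> z" "z \<le> 1"
  show "\<bar>(case (x, z) of (x, z) \<Rightarrow> drift_density a s x z)\<bar> \<le> decay_const a s x * sqrt z"
  proof (cases "z = 0")
    case False
    then have "drift_density a s x z \<le> drift_density a s x z / z\<^sup>2"
      using xz drift_density_nonneg[of a s x z]
      by (simp add: pos_le_divide_eq mult_left_le power_le_one)
    also have "\<dots> \<le> decay_const a s x * sqrt z"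
      using drift_density_decay[of s x z a] assms xz False by simp
    finally show ?thesis using drift_density_nonneg[of a s x z] by simp
  qed simp
qed (use assms in auto)

lemma continuous_on_conga_kernel:
  assumes "0 < s" "0 < a" "0 < x"
  shows "continuous_on {0..1} (conga_kernel a s x)"
proof -
  have "continuous_on ({0<..} \<times> {0..1}) (\<lambda>(x, z). (x + a * z) / (2 * z) * drift_density a s x z)"
  proof (rule continuous_on_times_closed_interval)
    show "continuous_on ({0<..} \<times> {0<..}) (\<lambda>(x, z). (x + a * z) / (2 * z) * drift_density a s x z)"
      using continuous_on_drift_density_open[OF assms(1), of a]
      unfolding case_prod_unfold by (intro continuous_intros) auto
    show "continuous_on {0<..} (\<lambda>x. (x + a) * decay_const a s x)"
      using assms by (intro continuous_intros continuous_on_decay_const) auto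
    fix x z :: real assume xz: "0 < x" "0 \<le> z" "z \<le> 1"
    show "\<bar>case (x, z) of (x, z) \<Rightarrow> (x + a * z) / (2 * z) * drift_density a s x z\<bar>
        \<le> (x + a) * decay_const a s x * sqrt z"
    proof (cases "z = 0")
      case False
      have "(x + a * z) / (2 * z) * drift_density a s x z
          = ((x + a * z) * z / 2) * (drift_density a s x z / z\<^sup>2)"
        using False by (simp add: field_simps power2_eq_square)
      also have "\<dots> \<le> (x + a) * (decay_const a s x * sqrt z)"
      proof (intro mult_mono)
        have "(x + a * z) * z \<le> (x + a * 1) * 1"
          using xz assms by (intro mult_mono add_mono) auto
        then show "(x + a * z) * z / 2 \<le> x + a" using xz assms by simp
        show "drift_density a s x z / z\<^sup>2 \<le> decay_const a s x * sqrt z"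
          using drift_density_decay[of s x z a] assms xz False by simp
      qed (use xz assms drift_density_nonneg[of a s x z] in auto)
      finally show ?thesis
        using xz assms drift_density_nonneg[of a s x z] by (simp add: mult.assoc)
    qed simp
  qed
  then have "continuous_on {0..1}
      (\<lambda>z. case (x, z) of (x, z) \<Rightarrow> (x + a * z) / (2 * z) * drift_density a s x z)"
    by (rule continuous_on_compose2) (use assms in \<open>auto intro!: continuous_intros\<close>)
  then show ?thesis
    by (rule continuous_on_eq) (use assms in \<open>auto simp: conga_kernel_eq\<close>)
qed

section \<open>The velocity of the Conga line as a sum over increments\<close>

lemma conga_line_eq:
  "conga_line \<alpha> t w x = (LINT z:{0..1}|lborel. conga_kernel \<alpha> (sigma_t \<alpha> t) x z *\<^sub>R w (1 - z))"
  by (simp add: conga_line_def conga_kernel_def)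

lemma has_vector_derivative_conga_line:
  fixes w :: "real \<Rightarrow> real^2"
  assumes \<alpha>: "0 < \<alpha>" and s: "0 < sigma_t \<alpha> t" and w: "continuous_on {0..1} w" and x: "0 < x"
  shows "(conga_line \<alpha> t w has_vector_derivative
    integral {0..1} (\<lambda>z. conga_kernel_deriv \<alpha> (sigma_t \<alpha> t) x z *\<^sub>R w (1 - z))) (at x)"
proof -
  define s where "s = sigma_t \<alpha> t"
  have s_pos: "0 < s" using s by (simp add: s_def)
  have w': "continuous_on {0..1} (\<lambda>z. w (1 - z))"
    by (rule continuous_on_compose2[OF w]) (auto intro!: continuous_intros)
  have contK: "continuous_on {0..1} (\<lambda>z. conga_kernel \<alpha> s y z *\<^sub>R w (1 - z))" if "0 < y" for y
    using continuous_on_conga_kernel[OF s_pos \<alpha> that] w' by (intro continuous_intros)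
  have line: "conga_line \<alpha> t w y = integral {0..1} (\<lambda>z. conga_kernel \<alpha> s y z *\<^sub>R w (1 - z))"
    if "0 < y" for y
    unfolding conga_line_eq s_def[symmetric]
    by (intro set_borel_integral_eq_integral borel_integrable_atLeastAtMost' contK that)
  have "((\<lambda>x. integral (cbox 0 1) (\<lambda>z. conga_kernel \<alpha> s x z *\<^sub>R w (1 - z))) has_vector_derivative
      integral (cbox 0 1) (\<lambda>z. conga_kernel_deriv \<alpha> s x z *\<^sub>R w (1 - z))) (at x within {0<..})"
  proof (rule leibniz_rule_vector_derivative)
    fix y z :: real assume y: "y \<in> {0<..}" and z: "z \<in> cbox 0 1"
    have "((\<lambda>x. conga_kernel \<alpha> s x z) has_real_derivative conga_kernel_deriv \<alpha> s y z) (at y)"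
    proof (cases "z = 0")
      case True
      then show ?thesis using s_pos by (simp add: conga_kernel_eq conga_kernel_deriv_def)
    next
      case False
      then show ?thesis using has_real_derivative_conga_kernel[OF s_pos, of z] z by auto
    qed
    then have "((\<lambda>x. conga_kernel \<alpha> s x z) has_real_derivative conga_kernel_deriv \<alpha> s y z) (at y within {0<..})"
      by (rule has_field_derivative_at_within)
    then show "((\<lambda>x. conga_kernel \<alpha> s x z *\<^sub>R w (1 - z)) has_vector_derivative
        conga_kernel_deriv \<alpha> s y z *\<^sub>R w (1 - z)) (at y within {0<..})"
      by (auto intro!: derivative_eq_intros)
  next
    fix y :: real assume "y \<in> {0<..}"
    then show "(\<lambda>z. conga_kernel \<alpha> s y z *\<^sub>R w (1 - z)) integrable_on cbox 0 1"
      using contK[of y] by (intro integrable_continuous) auto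
  next
    have "continuous_on ({0<..} \<times> {0..1}) (\<lambda>p. (case p of (x, z) \<Rightarrow> conga_kernel_deriv \<alpha> s x z) *\<^sub>R w (1 - snd p))"
      by (intro continuous_intros continuous_on_conga_kernel_deriv s_pos continuous_on_compose2[OF w]) auto
    then show "continuous_on ({0<..} \<times> cbox 0 1) (\<lambda>(x, z). conga_kernel_deriv \<alpha> s x z *\<^sub>R w (1 - z))"
      by (simp add: case_prod_unfold)
  qed (use x in auto)
  then have "((\<lambda>x. integral {0..1} (\<lambda>z. conga_kernel \<alpha> s x z *\<^sub>R w (1 - z))) has_vector_derivative
      integral {0..1} (\<lambda>z. conga_kernel_deriv \<alpha> s x z *\<^sub>R w (1 - z))) (at x)"
    using x by (simp add: at_within_open[of x "{0<..}"])
  then show ?thesis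
    unfolding s_def[symmetric]
    by (rule has_vector_derivative_transform_within_open[of _ _ _ "{0<..}"]) (use x line in auto)
qed

lemma sum_by_parts:
  fixes G :: "nat \<Rightarrow> real" and w :: "nat \<Rightarrow> 'b::real_vector"
  shows "(\<Sum>i<n. (G i - G (Suc i)) *\<^sub>R w i)
    = G 0 *\<^sub>R w 0 - G n *\<^sub>R w n + (\<Sum>i<n. G (Suc i) *\<^sub>R (w (Suc i) - w i))"
  by (induction n) (auto simp: algebra_simps)

lemma has_integral_conga_kernel_deriv:
  assumes "0 < s" "0 < x" "0 \<le> p" "p \<le> q" "q \<le> 1"
  shows "(conga_kernel_deriv a s x has_integral drift_density a s x p - drift_density a s x q) {p..q}"
proof -
  have "continuous_on {p..q} (\<lambda>z. case (x, z) of (x, z) \<Rightarrow> drift_density a s x z)"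
    by (rule continuous_on_compose2[OF continuous_on_drift_density[OF assms(1)]])
       (use assms in \<open>auto intro!: continuous_intros\<close>)
  then have "continuous_on {p..q} (\<lambda>z. - drift_density a s x z)"
    by (auto intro!: continuous_intros)
  then have "(conga_kernel_deriv a s x has_integral - drift_density a s x q - (- drift_density a s x p)) {p..q}"
  proof (rule fundamental_theorem_of_calculus_interior[OF assms(4)])
    fix z assume "z \<in> {p<..<q}"
    then have "((\<lambda>z. - drift_density a s x z) has_real_derivative - (- conga_kernel_deriv a s x z)) (at z)"
      using assms by (intro DERIV_minus has_real_derivative_drift_density) auto
    then show "((\<lambda>z. - drift_density a s x z) has_vector_derivative conga_kernel_deriv a s x z) (at z)"
      by (simp add: has_real_derivative_iff_has_vector_derivative)
  qed
  then show ?thesis by simp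
qed

text \<open>
  Minus the velocity at \<open>x\<close> of the Conga line of the step path with values \<open>w (i / n)\<close> on the intervals
  between \<open>i / n\<close> and \<open>(i + 1) / n\<close>.  The jump at time \<open>(i + 1) / n\<close> enters with the density at
  \<open>z = 1 - (i + 1) / n\<close>.  The starting point is kept although Brownian motion starts at \<open>0\<close>: it does so
  only almost surely, and the limit over \<open>n\<close> has to hold for every path for the length to be measurable.
\<close>

definition increment_velocity ::
    "real \<Rightarrow> real \<Rightarrow> nat \<Rightarrow> (real \<Rightarrow> 'b::real_vector) \<Rightarrow> real \<Rightarrow> 'b" where
  "increment_velocity a s n w x = drift_density a s x 1 *\<^sub>R w 0
    + (\<Sum>i<n. drift_density a s x (1 - real (Suc i) / real n) *\<^sub>R (w (real (Suc i) / real n) - w (real i / real n)))"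

text \<open>
  On each interval of length \<open>1 / n\<close> freeze the path; the error is at most \<open>B * e / n\<close>, and the integral
  of the frozen integrand is a difference of densities.  Summation by parts then moves the differences from
  the densities to the path.  The intervals are joined from \<open>z = 1\<close> downwards, so that the path is
  visited in the order of its own time \<open>1 - z\<close>.
\<close>

lemma integral_conga_kernel_deriv_approx:
  fixes w :: "real \<Rightarrow> 'b::euclidean_space"
  assumes s: "0 < s" and x: "0 < x" and n: "0 < n" and w: "continuous_on {0..1} w"
    and B: "\<And>z. 0 \<le> z \<Longrightarrow> z \<le> 1 \<Longrightarrow> \<bar>conga_kernel_deriv a s x z\<bar> \<le> B"
    and osc: "\<And>u v. u \<in> {0..1} \<Longrightarrow> v \<in> {0..1} \<Longrightarrow> \<bar>u - v\<bar> \<le> 1 / real n \<Longrightarrow> norm (w u - w v) \<le> e"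
  shows "norm (integral {0..1} (\<lambda>z. conga_kernel_deriv a s x z *\<^sub>R w (1 - z)) + increment_velocity a s n w x)
    \<le> B * e"
proof -
  define d where "d = conga_kernel_deriv a s x"
  define G where "G i = drift_density a s x (1 - real i / real n)" for i
  define I where "I p q = integral {p..q} (\<lambda>z. d z *\<^sub>R w (1 - z))" for p q
  have contd: "continuous_on {0..1} d"
  proof -
    have "continuous_on {0..1} (\<lambda>z. case (x, z) of (x, z) \<Rightarrow> conga_kernel_deriv a s x z)"
      by (rule continuous_on_compose2[OF continuous_on_conga_kernel_deriv[OF s]])
         (use x in \<open>auto intro!: continuous_intros\<close>)
    then show ?thesis by (simp add: d_def)
  qed
  have w': "continuous_on {0..1} (\<lambda>z. w (1 - z))"
    by (rule continuous_on_compose2[OF w]) (auto intro!: continuous_intros)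
  have "0 \<le> B" using B[of 0] by simp
  have "norm (I (1 - real k / real n) 1 + (\<Sum>i<k. (G i - G (Suc i)) *\<^sub>R w (real i / real n)))
      \<le> B * e * (real k / real n)" if "k \<le> n" for k
    using that
  proof (induction k)
    case 0
    then show ?case by (simp add: I_def)
  next
    case (Suc k)
    define p where "p = 1 - real (Suc k) / real n"
    define q where "q = 1 - real k / real n"
    have pq: "0 \<le> p" "p \<le> q" "q \<le> 1" "q - p = 1 / real n"
      using Suc.prems n by (auto simp: p_def q_def field_simps)
    have sub: "{p..q} \<subseteq> {0..1}" "{p..1} \<subseteq> {0..1}" using pq by auto
    have cont: "continuous_on {0..1} (\<lambda>z. d z *\<^sub>R w (1 - z))"
      by (intro continuous_intros contd w')
    have split: "I p 1 = I p q + I q 1"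
      unfolding I_def using pq
      by (intro Henstock_Kurzweil_Integration.integral_combine[symmetric] integrable_continuous_real
          continuous_on_subset[OF cont sub(2)]) auto
    have hd: "(d has_integral (G (Suc k) - G k)) {p..q}"
      using has_integral_conga_kernel_deriv[OF s x pq(1-3), of a] by (simp add: d_def G_def p_def q_def)
    have "((\<lambda>z. d z *\<^sub>R w (1 - z) - d z *\<^sub>R w (real k / real n)) has_integral
        I p q - (G (Suc k) - G k) *\<^sub>R w (real k / real n)) {p..q}"
      unfolding I_def
      by (intro has_integral_diff integrable_integral has_integral_scaleR_left hd
          integrable_continuous_real continuous_on_subset[OF cont sub(1)])
    then have step: "I p q + (G k - G (Suc k)) *\<^sub>R w (real k / real n)
        = integral {p..q} (\<lambda>z. d z *\<^sub>R (w (1 - z) - w (real k / real n)))"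
      by (simp add: algebra_simps integral_unique)
    have "norm (integral {p..q} (\<lambda>z. d z *\<^sub>R (w (1 - z) - w (real k / real n)))) \<le> (B * e) * (q - p)"
    proof (rule integral_bound)
      show "continuous_on {p..q} (\<lambda>z. d z *\<^sub>R (w (1 - z) - w (real k / real n)))"
        by (intro continuous_on_subset[OF _ sub(1)] continuous_intros contd w')
      fix z assume z: "z \<in> {p..q}"
      have "norm (w (1 - z) - w (real k / real n)) \<le> e"
      proof (rule osc)
        show "1 - z \<in> {0..1}" using z pq by auto
        show "real k / real n \<in> {0..1}" using Suc.prems n by auto
        have "1 - z - real k / real n = q - z" by (simp add: q_def)
        then show "\<bar>1 - z - real k / real n\<bar> \<le> 1 / real n" using z pq by auto
      qed
      moreover have "\<bar>d z\<bar> \<le> B" using B[of z] z pq by (simp add: d_def)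
      ultimately show "norm (d z *\<^sub>R (w (1 - z) - w (real k / real n))) \<le> B * e"
        using \<open>0 \<le> B\<close> by (auto intro!: mult_mono)
    qed (use pq in auto)
    then have "norm (I p q + (G k - G (Suc k)) *\<^sub>R w (real k / real n)) \<le> B * e * (1 / real n)"
      using step pq(4) by simp
    moreover have "norm (I q 1 + (\<Sum>i<k. (G i - G (Suc i)) *\<^sub>R w (real i / real n))) \<le> B * e * (real k / real n)"
      using Suc by (simp add: q_def)
    ultimately have "norm ((I p q + (G k - G (Suc k)) *\<^sub>R w (real k / real n))
        + (I q 1 + (\<Sum>i<k. (G i - G (Suc i)) *\<^sub>R w (real i / real n))))
      \<le> B * e * (1 / real n) + B * e * (real k / real n)"
      by (rule norm_triangle_mono)
    moreover have "B * e * (1 / real n) + B * e * (real k / real n) = B * e * (real (Suc k) / real n)"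
      by (simp add: algebra_simps add_divide_distrib)
    moreover have "(I p q + (G k - G (Suc k)) *\<^sub>R w (real k / real n))
        + (I q 1 + (\<Sum>i<k. (G i - G (Suc i)) *\<^sub>R w (real i / real n)))
      = I p 1 + (\<Sum>i<Suc k. (G i - G (Suc i)) *\<^sub>R w (real i / real n))"
      unfolding split by (simp only: sum.lessThan_Suc) (simp only: add_ac)
    ultimately show ?case unfolding p_def[symmetric] by simp
  qed
  from this[of n] have "norm (I 0 1 + (\<Sum>i<n. (G i - G (Suc i)) *\<^sub>R w (real i / real n))) \<le> B * e"
    using n by simp
  moreover have "(\<Sum>i<n. (G i - G (Suc i)) *\<^sub>R w (real i / real n)) = increment_velocity a s n w x"
    using n unfolding sum_by_parts[of G "\<lambda>i. w (real i / real n)"]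
    by (simp add: G_def increment_velocity_def)
  ultimately show ?thesis by (simp add: I_def d_def)
qed

lemma continuous_on_increment_velocity:
  fixes w :: "real \<Rightarrow> 'b::real_normed_vector"
  assumes "0 < s"
  shows "continuous_on {0<..} (increment_velocity a s n w)"
proof -
  have dens: "continuous_on {0<..} (\<lambda>x. drift_density a s x z)" if "0 \<le> z" "z \<le> 1" for z
  proof -
    have "continuous_on {0<..} (\<lambda>x. case (x, z) of (x, z) \<Rightarrow> drift_density a s x z)"
      by (rule continuous_on_compose2[OF continuous_on_drift_density[OF assms]])
         (use that in \<open>auto intro!: continuous_intros\<close>)
    then show ?thesis by simp
  qed
  show ?thesis
    unfolding increment_velocity_def by (intro continuous_intros dens) auto
qed

text \<open>
  The kernel derivative is bounded uniformly in \<open>x\<close> on \<open>[\<delta>, \<alpha>]\<close> and the path is uniformly continuous, so the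
  velocities of the step paths converge uniformly.
\<close>

lemma conga_length_eq_lim:
  fixes w :: "real \<Rightarrow> real^2"
  assumes \<alpha>: "0 < \<alpha>" and s: "0 < sigma_t \<alpha> t" and \<delta>: "0 < \<delta>" and w: "continuous_on {0..1} w"
  shows "(\<lambda>n. LINT x:{\<delta>..\<alpha>}|lborel. norm (increment_velocity \<alpha> (sigma_t \<alpha> t) n w x))
    \<longlonglongrightarrow> conga_length \<alpha> \<delta> t w"
proof -
  define s where "s = sigma_t \<alpha> t"
  have s_pos: "0 < s" using s by (simp add: s_def)
  define v where "v x = integral {0..1} (\<lambda>z. conga_kernel_deriv \<alpha> s x z *\<^sub>R w (1 - z))" for x
  define c where "c x = decay_const \<alpha> s x * (1 / 2 + (x\<^sup>2 + \<alpha>\<^sup>2) / (2 * s\<^sup>2))" for x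
  have "continuous_on {\<delta>..\<alpha>} c"
    unfolding c_def using \<delta> s_pos
    by (intro continuous_intros continuous_on_subset[OF continuous_on_decay_const]) auto
  then have "bounded (c ` {\<delta>..\<alpha>})"
    by (intro compact_imp_bounded compact_continuous_image) auto
  then obtain B where B: "0 < B" "\<And>x. x \<in> {\<delta>..\<alpha>} \<Longrightarrow> \<bar>c x\<bar> \<le> B"
    unfolding bounded_pos by auto
  have dB: "\<bar>conga_kernel_deriv \<alpha> s x z\<bar> \<le> B" if x: "x \<in> {\<delta>..\<alpha>}" and z: "0 \<le> z" "z \<le> 1" for x z
  proof -
    have "\<bar>conga_kernel_deriv \<alpha> s x z\<bar> \<le> c x * sqrt z"
      unfolding c_def using conga_kernel_deriv_decay[OF s_pos, of x z \<alpha>] x z \<delta> by simp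
    also have "\<dots> \<le> B * 1"
      using B(1) B(2)[OF x] z by (intro mult_mono) auto
    finally show ?thesis by simp
  qed
  have lim: "uniform_limit {\<delta>..\<alpha>} (\<lambda>n x. norm (increment_velocity \<alpha> s n w x)) (\<lambda>x. norm (v x)) sequentially"
    unfolding uniform_limit_iff
  proof (intro allI impI)
    fix e :: real assume "0 < e"
    define e' where "e' = e / (2 * B)"
    have "0 < e'" using \<open>0 < e\<close> B by (simp add: e'_def)
    have "uniformly_continuous_on {0..1} w"
      using w by (rule compact_uniformly_continuous) simp
    then obtain d where d: "0 < d"
      "\<And>u u'. u \<in> {0..1} \<Longrightarrow> u' \<in> {0..1} \<Longrightarrow> dist u' u < d \<Longrightarrow> dist (w u') (w u) < e'"
      using \<open>0 < e'\<close> unfolding uniformly_continuous_on_def by blast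
    have "(\<lambda>n. 1 / real n) \<longlonglongrightarrow> 0" by (rule lim_1_over_n)
    then have "\<forall>\<^sub>F n in sequentially. 1 / real n < d"
      using d(1) by (rule order_tendstoD)
    then show "\<forall>\<^sub>F n in sequentially. \<forall>x\<in>{\<delta>..\<alpha>}. dist (norm (increment_velocity \<alpha> s n w x)) (norm (v x)) < e"
      using eventually_gt_at_top[of 0]
    proof eventually_elim
      case (elim n)
      show ?case
      proof
        fix x assume x: "x \<in> {\<delta>..\<alpha>}"
        have "norm (v x + increment_velocity \<alpha> s n w x) \<le> B * e'"
          unfolding v_def
        proof (rule integral_conga_kernel_deriv_approx[OF s_pos _ elim(2) w dB[OF x]])
          fix u u' :: real assume "u \<in> {0..1}" "u' \<in> {0..1}" "\<bar>u - u'\<bar> \<le> 1 / real n"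
          then show "norm (w u - w u') \<le> e'"
            using d(2)[of u' u] elim(1) by (auto simp: dist_norm)
        qed (use x \<delta> in auto)
        also have "\<dots> < e" using \<open>0 < e\<close> B by (simp add: e'_def)
        finally have "norm (v x + increment_velocity \<alpha> s n w x) < e" .
        moreover have "\<bar>norm (increment_velocity \<alpha> s n w x) - norm (v x)\<bar>
            \<le> norm (v x + increment_velocity \<alpha> s n w x)"
          using norm_triangle_ineq3[of "increment_velocity \<alpha> s n w x" "- v x"] by (simp add: add.commute)
        ultimately show "dist (norm (increment_velocity \<alpha> s n w x)) (norm (v x)) < e"
          by (simp add: dist_real_def)
      qed
    qed
  qed
  have contn: "continuous_on {\<delta>..\<alpha>} (\<lambda>x. norm (increment_velocity \<alpha> s n w x))" for n
    using \<delta> by (intro continuous_intros continuous_on_subset[OF continuous_on_increment_velocity[OF s_pos]]) auto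
  have contv: "continuous_on {\<delta>..\<alpha>} (\<lambda>x. norm (v x))"
    by (rule uniform_limit_theorem[OF _ lim]) (auto intro: always_eventually contn)
  have len: "conga_length \<alpha> \<delta> t w = integral {\<delta>..\<alpha>} (\<lambda>x. norm (v x))"
  proof -
    have "conga_length \<alpha> \<delta> t w = (LINT x:{\<delta>..\<alpha>}|lborel. norm (v x))"
      unfolding conga_length_def
    proof (rule set_lebesgue_integral_cong)
      show "\<forall>x. x \<in> {\<delta>..\<alpha>} \<longrightarrow> norm (vector_derivative (conga_line \<alpha> t w) (at x)) = norm (v x)"
      proof (intro allI impI)
        fix x assume "x \<in> {\<delta>..\<alpha>}"
        then have "0 < x" using \<delta> by simp
        from vector_derivative_at[OF has_vector_derivative_conga_line[OF \<alpha> s w this]]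
        show "norm (vector_derivative (conga_line \<alpha> t w) (at x)) = norm (v x)"
          by (simp add: v_def s_def)
      qed
    qed simp
    then show ?thesis
      using set_borel_integral_eq_integral(2)[OF borel_integrable_atLeastAtMost'[OF contv]] by simp
  qed
  obtain I J where IJ: "\<And>n. ((\<lambda>x. norm (increment_velocity \<alpha> s n w x)) has_integral I n) {\<delta>..\<alpha>}"
    "((\<lambda>x. norm (v x)) has_integral J) {\<delta>..\<alpha>}" "I \<longlonglongrightarrow> J"
    using lim contn by (rule uniform_limit_integral) auto
  have "(\<lambda>n. integral {\<delta>..\<alpha>} (\<lambda>x. norm (increment_velocity \<alpha> s n w x))) \<longlonglongrightarrow> integral {\<delta>..\<alpha>} (\<lambda>x. norm (v x))"
    using IJ(3) by (simp only: integral_unique[OF IJ(1)] integral_unique[OF IJ(2)])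
  then show ?thesis
    using set_borel_integral_eq_integral(2)[OF borel_integrable_atLeastAtMost'[OF contn]]
    by (simp add: len s_def)
qed

section \<open>Concentration of the length\<close>

lemma integral_drift_density_le_1:
  assumes "0 < s" "0 \<le> z"
  shows "integrable lborel (\<lambda>x. drift_density a s x z)"
    and "(\<integral>x. drift_density a s x z \<partial>lborel) \<le> 1"
proof -
  have "integrable lborel (\<lambda>x. drift_density a s x z) \<and> (\<integral>x. drift_density a s x z \<partial>lborel) \<le> 1"
  proof (cases "z = 0")
    case False
    then have "0 < s * sqrt z" using assms by simp
    then show ?thesis
      unfolding drift_density_def by simp
  qed simp
  then show "integrable lborel (\<lambda>x. drift_density a s x z)"
    and "(\<integral>x. drift_density a s x z \<partial>lborel) \<le> 1" by auto
qed

lemma set_integral_norm_sum_lipschitz: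
  fixes y y' :: "'i \<Rightarrow> 'b::{banach, second_countable_topology}" and h :: "'i \<Rightarrow> 'c \<Rightarrow> real"
  assumes int[simp]: "\<And>i. i \<in> I \<Longrightarrow> integrable N (h i)" and nonneg: "\<And>i x. 0 \<le> h i x"
    and le1: "\<And>i. i \<in> I \<Longrightarrow> (\<integral>x. h i x \<partial>N) \<le> 1" and A[measurable]: "A \<in> sets N"
  shows "(LINT x:A|N. norm (\<Sum>i\<in>I. h i x *\<^sub>R y i))
    \<le> (LINT x:A|N. norm (\<Sum>i\<in>I. h i x *\<^sub>R y' i)) + (\<Sum>i\<in>I. norm (y i - y' i))"
proof -
  have intn: "integrable N (\<lambda>x. indicator A x *\<^sub>R norm (\<Sum>i\<in>I. h i x *\<^sub>R u i))" for u :: "'i \<Rightarrow> 'b"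
    by (intro integrable_mult_indicator A integrable_norm Bochner_Integration.integrable_sum
        integrable_scaleR_left) simp
  have intd: "integrable N (\<lambda>x. \<Sum>i\<in>I. h i x * norm (y i - y' i))"
    by (intro Bochner_Integration.integrable_sum integrable_mult_left) simp
  have "(LINT x:A|N. norm (\<Sum>i\<in>I. h i x *\<^sub>R y i))
      \<le> (\<integral>x. indicator A x *\<^sub>R norm (\<Sum>i\<in>I. h i x *\<^sub>R y' i) + (\<Sum>i\<in>I. h i x * norm (y i - y' i)) \<partial>N)"
    unfolding set_lebesgue_integral_def
  proof (rule integral_mono[OF intn Bochner_Integration.integrable_add[OF intn intd]])
    fix x
    have "(\<Sum>i\<in>I. h i x *\<^sub>R y i) = (\<Sum>i\<in>I. h i x *\<^sub>R y' i) + (\<Sum>i\<in>I. h i x *\<^sub>R (y i - y' i))"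
      by (simp add: scaleR_diff_right sum_subtractf)
    also have "norm \<dots> \<le> norm (\<Sum>i\<in>I. h i x *\<^sub>R y' i) + (\<Sum>i\<in>I. h i x * norm (y i - y' i))"
      using norm_sum[of "\<lambda>i. h i x *\<^sub>R (y i - y' i)" I] nonneg
      by (intro norm_triangle_le add_left_mono) auto
    finally show "indicator A x *\<^sub>R norm (\<Sum>i\<in>I. h i x *\<^sub>R y i)
        \<le> indicator A x *\<^sub>R norm (\<Sum>i\<in>I. h i x *\<^sub>R y' i) + (\<Sum>i\<in>I. h i x * norm (y i - y' i))"
      by (auto simp: indicator_def intro!: sum_nonneg mult_nonneg_nonneg nonneg)
  qed
  also have "\<dots> = (LINT x:A|N. norm (\<Sum>i\<in>I. h i x *\<^sub>R y' i)) + (\<integral>x. (\<Sum>i\<in>I. h i x * norm (y i - y' i)) \<partial>N)"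
    unfolding set_lebesgue_integral_def by (rule Bochner_Integration.integral_add[OF intn intd])
  also have "(\<integral>x. (\<Sum>i\<in>I. h i x * norm (y i - y' i)) \<partial>N) = (\<Sum>i\<in>I. (\<integral>x. h i x \<partial>N) * norm (y i - y' i))"
    by (subst Bochner_Integration.integral_sum) auto
  also have "\<dots> \<le> (\<Sum>i\<in>I. 1 * norm (y i - y' i))"
    by (intro sum_mono mult_right_mono le1) auto
  finally show ?thesis by simp
qed

text \<open>
  The \<open>n\<close> increments are independent Gaussian vectors of variance \<open>1 / n\<close>, so each contributes a factor
  \<open>exp (4 d \<kappa>\<^sup>2 / n)\<close> in dimension \<open>d\<close>.
\<close>

lemma (in standard_brownian_motion) increments_exp_moment_product:
  fixes \<Phi> :: "(nat \<Rightarrow> 'b) \<Rightarrow> real" and n :: nat and \<kappa> :: real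
  defines "\<xi> \<equiv> \<lambda>\<omega>. \<lambda>i\<in>{..<n}. W (real (Suc i) / real n) \<omega> - W (real i / real n) \<omega>"
  assumes n: "0 < n" "4 * \<kappa>\<^sup>2 \<le> real n" and \<kappa>: "0 \<le> \<kappa>"
    and \<Phi>[measurable]: "\<Phi> \<in> borel_measurable (Pi\<^sub>M {..<n} (\<lambda>_. borel))"
    and lip: "\<And>y y'. \<Phi> y \<le> \<Phi> y' + (\<Sum>i<n. norm (y i - y' i))"
  shows "(\<integral>\<^sup>+\<omega>. ennreal (exp (\<kappa> * \<Phi> (\<xi> \<omega>))) \<partial>M) * (\<integral>\<^sup>+\<omega>. ennreal (exp (- (\<kappa> * \<Phi> (\<xi> \<omega>)))) \<partial>M)
    \<le> ennreal (exp (4 * DIM('b) * \<kappa>\<^sup>2))"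
proof -
  define \<tau> where "\<tau> = sqrt (1 / real n)"
  have \<tau>: "0 < \<tau>" "\<tau>\<^sup>2 = 1 / real n" using n by (auto simp: \<tau>_def)
  define \<mu> where "\<mu> = density lborel (\<lambda>y::'b. ennreal (\<Prod>b\<in>Basis. normal_density 0 \<tau> (y \<bullet> b)))"
  have sets_\<mu>[measurable_cong]: "sets \<mu> = sets borel" by (simp add: \<mu>_def)
  define X where "X i \<omega> = W (real (Suc i) / real n) \<omega> - W (real i / real n) \<omega>" for i \<omega>
  have Xm: "X i \<in> borel_measurable M" if "i < n" for i
    unfolding X_def using that n by (intro borel_measurable_diff measurable_W) auto
  have distr_X: "distr M borel (X i) = \<mu>" if "i < n" for i
  proof -
    have "real (Suc i) / real n - real i / real n = 1 / real n"
      by (simp add: diff_divide_distrib[symmetric])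
    moreover have "distributed M lborel (X i) (\<lambda>y. ennreal (\<Prod>b\<in>Basis.
        normal_density 0 (sqrt (real (Suc i) / real n - real i / real n)) (y \<bullet> b)))"
      unfolding X_def using that n by (intro normal_increments) (auto simp: divide_simps)
    ultimately have "distr M lborel (X i) = \<mu>"
      by (simp add: distributed_distr_eq_density \<mu>_def \<tau>_def)
    moreover have "distr M borel (X i) = distr M lborel (X i)" by (intro distr_cong) auto
    ultimately show ?thesis by simp
  qed
  have "prob_space \<mu>" using prob_space_distr[OF Xm[OF n(1)]] distr_X[OF n(1)] by simp
  have "indep_vars (\<lambda>_. borel) (\<lambda>i \<omega>. W (real (Suc i) / real n) \<omega> - W (real i / real n) \<omega>) {..<n}"
    using n by (intro indep_increments) (auto simp: divide_simps)
  then have "indep_vars (\<lambda>_. borel) X {..<n}" by (simp add: X_def[abs_def])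
  then have "distr M (Pi\<^sub>M {..<n} (\<lambda>_. borel)) \<xi> = Pi\<^sub>M {..<n} (\<lambda>i. distr M borel (X i))"
    using n Xm by (subst (asm) indep_vars_iff_distr_eq_PiM') (auto simp: \<xi>_def X_def)
  also have "\<dots> = Pi\<^sub>M {..<n} (\<lambda>_. \<mu>)" by (intro PiM_cong) (auto simp: distr_X)
  finally have D: "distr M (Pi\<^sub>M {..<n} (\<lambda>_. borel)) \<xi> = Pi\<^sub>M {..<n} (\<lambda>_. \<mu>)" .
  have \<xi>m[measurable]: "\<xi> \<in> measurable M (Pi\<^sub>M {..<n} (\<lambda>_. borel))"
    unfolding \<xi>_def using Xm unfolding X_def[abs_def] by (intro measurable_restrict) auto
  have transfer: "(\<integral>\<^sup>+\<omega>. f (\<xi> \<omega>) \<partial>M) = (\<integral>\<^sup>+y. f y \<partial>Pi\<^sub>M {..<n} (\<lambda>_. \<mu>))"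
    if "f \<in> borel_measurable (Pi\<^sub>M {..<n} (\<lambda>_. borel))" for f :: "_ \<Rightarrow> ennreal"
    unfolding D[symmetric] using that by (simp add: nn_integral_distr)
  define F where "F y = ennreal (exp (\<kappa> * \<Phi> y))" for y
  have Fm: "F \<in> borel_measurable (Pi\<^sub>M {..<n} (\<lambda>_. borel))"
    unfolding F_def by measurable
  have invF: "ennreal (exp (- (\<kappa> * \<Phi> y))) = inverse (F y)" for y
    by (simp add: F_def inverse_ennreal exp_minus)
  have "(\<integral>\<^sup>+y. F y \<partial>Pi\<^sub>M {..<n} (\<lambda>_. \<mu>)) * (\<integral>\<^sup>+y. inverse (F y) \<partial>Pi\<^sub>M {..<n} (\<lambda>_. \<mu>))
      \<le> ennreal (exp (4 * DIM('b) * \<kappa>\<^sup>2 * \<tau>\<^sup>2)) ^ card {..<n}"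
  proof (rule product_nn_integral_times_reciprocal_le[OF \<open>prob_space \<mu>\<close> sets_\<mu>])
    show "(\<integral>\<^sup>+y. \<integral>\<^sup>+y'. ennreal (cosh (\<kappa> * norm (y - y'))) \<partial>\<mu> \<partial>\<mu>)
        \<le> ennreal (exp (4 * DIM('b) * \<kappa>\<^sup>2 * \<tau>\<^sup>2))"
      unfolding \<mu>_def using n by (intro gaussian_cosh_moment \<tau>(1)) (simp add: \<tau>(2))
    have "sets (Pi\<^sub>M {..<n} (\<lambda>_. \<mu>)) = sets (Pi\<^sub>M {..<n} (\<lambda>_. borel :: 'b measure))"
      by (intro sets_PiM_cong) (auto simp: sets_\<mu>)
    then show "F \<in> borel_measurable (Pi\<^sub>M {..<n} (\<lambda>_. \<mu>))"
      using Fm by (simp cong: measurable_cong_sets)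
    fix y y' :: "nat \<Rightarrow> 'b"
    have "\<kappa> * \<Phi> y \<le> \<kappa> * (\<Phi> y' + (\<Sum>i<n. norm (y i - y' i)))"
      using lip \<kappa> by (intro mult_left_mono)
    then have "exp (\<kappa> * \<Phi> y) \<le> exp (\<kappa> * (\<Sum>i<n. norm (y i - y' i))) * exp (\<kappa> * \<Phi> y')"
      by (simp add: algebra_simps flip: exp_add)
    then show "F y \<le> ennreal (exp (\<kappa> * (\<Sum>i<n. norm (y i - y' i)))) * F y'"
      by (simp add: F_def flip: ennreal_mult')
  qed (auto simp: F_def)
  also have "\<dots> = ennreal (exp (4 * DIM('b) * \<kappa>\<^sup>2))"
    using n by (simp add: ennreal_power exp_of_nat_mult[symmetric] \<tau>(2))
  finally have "(\<integral>\<^sup>+y. F y \<partial>Pi\<^sub>M {..<n} (\<lambda>_. \<mu>)) * (\<integral>\<^sup>+y. inverse (F y) \<partial>Pi\<^sub>M {..<n} (\<lambda>_. \<mu>))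
      \<le> ennreal (exp (4 * DIM('b) * \<kappa>\<^sup>2))" .
  moreover have "(\<integral>\<^sup>+\<omega>. F (\<xi> \<omega>) \<partial>M) = (\<integral>\<^sup>+y. F y \<partial>Pi\<^sub>M {..<n} (\<lambda>_. \<mu>))"
    using Fm by (rule transfer)
  moreover have "(\<integral>\<^sup>+\<omega>. inverse (F (\<xi> \<omega>)) \<partial>M) = (\<integral>\<^sup>+y. inverse (F y) \<partial>Pi\<^sub>M {..<n} (\<lambda>_. \<mu>))"
    using Fm by (intro transfer) measurable
  ultimately show ?thesis
    unfolding invF F_def[symmetric] by simp
qed

text \<open>
  The constant \<open>8\<close> is \<open>4 d\<close> for the dimension \<open>d = 2\<close>.
\<close>

lemma conga_length_exp_moment_product:
  fixes W :: "real \<Rightarrow> 'a \<Rightarrow> real^2"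
  assumes "standard_brownian_motion M W" and \<alpha>: "0 < \<alpha>" and s_pos: "0 < sigma_t \<alpha> t" and \<delta>: "0 < \<delta>"
    and \<kappa>: "0 < \<kappa>"
  defines "l \<equiv> \<lambda>\<omega>. conga_length \<alpha> \<delta> t (\<lambda>u. W u \<omega>)"
  shows "l \<in> borel_measurable M"
    and "(\<integral>\<^sup>+\<omega>. ennreal (exp (\<kappa> * l \<omega>)) \<partial>M) * (\<integral>\<^sup>+\<omega>. ennreal (exp (- (\<kappa> * l \<omega>))) \<partial>M)
      \<le> ennreal (exp (8 * \<kappa>\<^sup>2))"
proof -
  interpret standard_brownian_motion M W by fact
  define s where "s = sigma_t \<alpha> t"
  have s: "0 < s" using s_pos by (simp add: s_def)
  define X where "X n \<omega> = (LINT x:{\<delta>..\<alpha>}|lborel. norm (increment_velocity \<alpha> s n (\<lambda>u. W u \<omega>) x))" for n \<omega>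
  have Xm: "X n \<in> borel_measurable M" for n
  proof -
    have [measurable]: "W 0 \<in> borel_measurable M" by (rule measurable_W) simp
    have Wm: "W (real i / real n) \<in> borel_measurable M" if "i \<le> n" for i
      using that by (intro measurable_W) (auto simp: divide_simps)
    have [measurable]: "(\<lambda>\<omega>. W (real (Suc i) / real n) \<omega> - W (real i / real n) \<omega>) \<in> borel_measurable M"
      if "i \<in> {..<n}" for i
      using Wm[of "Suc i"] Wm[of i] that by (intro borel_measurable_diff) auto
    have [measurable]: "(\<lambda>x. drift_density \<alpha> s x z) \<in> borel_measurable borel" for z
      unfolding drift_density_def by measurable
    have "(\<lambda>(\<omega>, x). indicator {\<delta>..\<alpha>} x *\<^sub>R norm (drift_density \<alpha> s x 1 *\<^sub>R W 0 \<omega>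
      + (\<Sum>i\<in>{..<n}. drift_density \<alpha> s x (1 - real (Suc i) / real n) *\<^sub>R
          (\<lambda>\<omega>. W (real (Suc i) / real n) \<omega> - W (real i / real n) \<omega>) \<omega>))) \<in> borel_measurable (M \<Otimes>\<^sub>M lborel)"
      by measurable
    then show ?thesis
      unfolding X_def set_lebesgue_integral_def increment_velocity_def
      by (intro lborel.borel_measurable_lebesgue_integral) simp
  qed
  have lim: "(\<lambda>n. X n \<omega>) \<longlonglongrightarrow> l \<omega>" if "\<omega> \<in> space M" for \<omega>
    unfolding X_def l_def s_def
    by (rule conga_length_eq_lim[OF \<alpha> s_pos \<delta> continuous_paths[OF that]])
  show "l \<in> borel_measurable M" by (rule borel_measurable_LIMSEQ_real[OF lim Xm])
  show "(\<integral>\<^sup>+\<omega>. ennreal (exp (\<kappa> * l \<omega>)) \<partial>M) * (\<integral>\<^sup>+\<omega>. ennreal (exp (- (\<kappa> * l \<omega>))) \<partial>M)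
      \<le> ennreal (exp (8 * \<kappa>\<^sup>2))"
  proof (rule nn_integral_exp_times_exp_minus_limit[where X = "\<lambda>n \<omega>. \<kappa> * X n \<omega>"])
    show "\<forall>\<^sub>F n in sequentially. (\<integral>\<^sup>+\<omega>. ennreal (exp (\<kappa> * X n \<omega>)) \<partial>M)
        * (\<integral>\<^sup>+\<omega>. ennreal (exp (- (\<kappa> * X n \<omega>))) \<partial>M) \<le> ennreal (exp (8 * \<kappa>\<^sup>2))"
      using eventually_gt_at_top[of 0] eventually_ge_at_top[of "nat \<lceil>4 * \<kappa>\<^sup>2\<rceil>"]
    proof eventually_elim
      case (elim n)
      define h where "h i x = drift_density \<alpha> s x (1 - real (Suc i) / real n)" for i x
      define \<Phi> where "\<Phi> y = (LINT x:{\<delta>..\<alpha>}|lborel. norm (\<Sum>i<n. h i x *\<^sub>R y i))" for y :: "nat \<Rightarrow> real^2"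
      define \<xi> where "\<xi> \<omega> = (\<lambda>i\<in>{..<n}. W (real (Suc i) / real n) \<omega> - W (real i / real n) \<omega>)" for \<omega>
      have "AE \<omega> in M. X n \<omega> = \<Phi> (\<xi> \<omega>)"
        using start
      proof eventually_elim
        case (elim \<omega>)
        then show ?case by (simp add: X_def \<Phi>_def \<xi>_def h_def increment_velocity_def)
      qed
      then have eq: "(\<integral>\<^sup>+\<omega>. g (X n \<omega>) \<partial>M) = (\<integral>\<^sup>+\<omega>. g (\<Phi> (\<xi> \<omega>)) \<partial>M)" for g :: "real \<Rightarrow> ennreal"
        by (intro nn_integral_cong_AE) auto
      have "(\<integral>\<^sup>+\<omega>. ennreal (exp (\<kappa> * \<Phi> (\<xi> \<omega>))) \<partial>M) * (\<integral>\<^sup>+\<omega>. ennreal (exp (- (\<kappa> * \<Phi> (\<xi> \<omega>)))) \<partial>M)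
        \<le> ennreal (exp (4 * DIM(real^2) * \<kappa>\<^sup>2))"
        unfolding \<xi>_def
      proof (rule increments_exp_moment_product[where \<Phi> = \<Phi> and n = n and \<kappa> = \<kappa>])
        show "4 * \<kappa>\<^sup>2 \<le> real n" using elim by linarith
        have [measurable]: "h i \<in> borel_measurable borel" for i
          unfolding h_def drift_density_def by measurable
        have "(\<lambda>(y, x). indicator {\<delta>..\<alpha>} x *\<^sub>R norm (\<Sum>i\<in>{..<n}. h i x *\<^sub>R y i))
            \<in> borel_measurable (Pi\<^sub>M {..<n} (\<lambda>_. borel :: (real^2) measure) \<Otimes>\<^sub>M lborel)"
          by measurable
        then show "\<Phi> \<in> borel_measurable (Pi\<^sub>M {..<n} (\<lambda>_. borel))"
          unfolding \<Phi>_def set_lebesgue_integral_def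
          by (intro lborel.borel_measurable_lebesgue_integral) simp
        show "\<Phi> y \<le> \<Phi> y' + (\<Sum>i<n. norm (y i - y' i))" for y y'
          unfolding \<Phi>_def
          by (rule set_integral_norm_sum_lipschitz)
             (use elim in \<open>auto simp: h_def drift_density_nonneg divide_simps intro!: integral_drift_density_le_1 s\<close>)
      qed (use elim \<kappa> in auto)
      then show ?case
        using eq[of "\<lambda>u. ennreal (exp (\<kappa> * u))"] eq[of "\<lambda>u. ennreal (exp (- (\<kappa> * u)))"] by simp
    qed
  qed (use Xm lim in \<open>auto intro!: tendsto_intros\<close>)
qed

theorem theorem5:
  fixes \<alpha> \<delta> :: real
  assumes "0 < \<alpha>" and "\<alpha> < 1" and "0 < \<delta>" and "\<delta> < \<alpha>"
  shows "\<exists>C\<^sub>1>0. \<exists>C\<^sub>2>0. \<forall>\<^sub>F t :: real in at_top.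
    \<forall>(M :: 'a measure) (W :: real \<Rightarrow> 'a \<Rightarrow> real^2). standard_brownian_motion M W \<longrightarrow>
      (\<forall>r>0. measure M {\<omega> \<in> space M.
          \<bar>conga_length \<alpha> \<delta> t (\<lambda>s. W s \<omega>)
            - integral\<^sup>L M (\<lambda>\<omega>'. conga_length \<alpha> \<delta> t (\<lambda>s. W s \<omega>'))\<bar> \<ge> r * sqrt (ln t)}
        \<le> C\<^sub>1 * exp (- C\<^sub>2 * r\<^sup>2))"
proof (rule exI[of _ 2], rule conjI[OF _ exI[of _ "1/32"]], simp, rule conjI, simp)
  show "\<forall>\<^sub>F t :: real in at_top.
    \<forall>(M :: 'a measure) (W :: real \<Rightarrow> 'a \<Rightarrow> real^2). standard_brownian_motion M W \<longrightarrow>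
      (\<forall>r>0. measure M {\<omega> \<in> space M.
          \<bar>conga_length \<alpha> \<delta> t (\<lambda>s. W s \<omega>)
            - integral\<^sup>L M (\<lambda>\<omega>'. conga_length \<alpha> \<delta> t (\<lambda>s. W s \<omega>'))\<bar> \<ge> r * sqrt (ln t)}
        \<le> 2 * exp (- (1/32) * r\<^sup>2))"
    using eventually_ge_at_top[of "exp 1 :: real"]
  proof eventually_elim
    case (elim t)
    have "0 < t" using exp_gt_zero elim by (rule less_le_trans)
    with elim have t: "0 < t" "1 \<le> ln t" by (simp_all add: ln_ge_iff)
    have "1 < t" using elim exp_ge_add_one_self[of "1::real"] by linarith
    have s: "0 < sigma_t \<alpha> t"
      using assms t by (simp add: sigma_t_def)
    show ?case
    proof (intro allI impI)
      fix M :: "'a measure" and W :: "real \<Rightarrow> 'a \<Rightarrow> real^2" and r :: real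
      assume bm: "standard_brownian_motion M W" and r: "0 < r"
      interpret standard_brownian_motion M W by (rule bm)
      have "measure M {\<omega> \<in> space M. \<bar>conga_length \<alpha> \<delta> t (\<lambda>s. W s \<omega>)
            - expectation (\<lambda>\<omega>'. conga_length \<alpha> \<delta> t (\<lambda>s. W s \<omega>'))\<bar> \<ge> r * sqrt (ln t)}
          \<le> 2 * exp (- ((r * sqrt (ln t))\<^sup>2 / (4 * 8)))"
        using conga_length_exp_moment_product[OF bm assms(1) s assms(3)] r t \<open>1 < t\<close>
        by (intro subgaussian_tail mult_pos_pos) (auto intro: zero_less_one)
      also have "\<dots> \<le> 2 * exp (- (1/32) * r\<^sup>2)"
        using t \<open>1 < t\<close> mult_left_mono[of 1 "ln t" "r\<^sup>2"] by (simp add: power_mult_distrib)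
      finally show "measure M {\<omega> \<in> space M. \<bar>conga_length \<alpha> \<delta> t (\<lambda>s. W s \<omega>)
            - expectation (\<lambda>\<omega>'. conga_length \<alpha> \<delta> t (\<lambda>s. W s \<omega>'))\<bar> \<ge> r * sqrt (ln t)}
          \<le> 2 * exp (- (1/32) * r\<^sup>2)" .
    qed
  qed
qed

end
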